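(* Assume (A0)–(A3) and let $\{(x^k,\lambda^k)\}$ be generated by the NEPJ-ADMM (with parameters satisfying $\delta_i>0$, $i=1,\dots,p$). Let $$\Delta\mathcal{L}_0:=\mathcal{L}_\beta(x^0,\lambda^0)-v(\beta)+\eta_0,\qquad \eta_0:=\frac{m_p}{4M_p^2}\|A_p^*\lambda^0-\nabla f_p(x_p^0)\|^2,$$ and let $$\delta_\lambda:=\left[\frac{\theta\gamma_\theta(p+1)}{\sigma^+_{A_p}\min_{1\le l\le p}\delta_l}\Big(2\beta^2\|A_p^*\|^2\max_{1\le l\le p-1}\|A_l\|^2+L_p^2+2M_p^2\Big)\right]^{-1}.$$ Then: (a) $\Delta\mathcal{L}_0\ge 0$; (b) for every $k\ge1$, $0\in\partial f_i(x_i^k)-A_i^*\hat\lambda^k+R_i^k$ for $i=1,\dots,p$, and there exists an index $j\le k$ such that $$\|R_i^j\|\le\Big[\sum_{l=1,l\ne i}^p\beta\|A_i^*A_l\|+M_i\Big]\sqrt{\frac{2\Delta\mathcal{L}_0}{k\min_{1\le l\le p}\delta_l}},\quad i=1,\dots,p,\qquad \Big\|\sum_{i=1}^pA_ix_i^j-b\Big\|\le\frac{1}{\beta\theta}\sqrt{\frac{2\Delta\mathcal{L}_0}{k\delta_\lambda}}.$$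
   Context: Problem: let $p\ge2$, $f_i:\mathbb{R}^{n_i}\to(-\infty,\infty]$ ($i=1,\dots,p$), $A_i\in\mathbb{R}^{d\times n_i}$, $b\in\mathbb{R}^d$, and consider $\min\{\sum_{i=1}^pf_i(x_i):\sum_{i=1}^pA_ix_i=b\}$. For $\beta>0$ the augmented Lagrangian is $\mathcal{L}_\beta(x_1,\dots,x_p,\lambda)=\sum_{i=1}^pf_i(x_i)-\langle\lambda,\sum_{i=1}^pA_ix_i-b\rangle+\frac\beta2\|\sum_{i=1}^pA_ix_i-b\|^2$. Standing assumptions: (A0) $f_1,\dots,f_{p-1}$ are proper lower semicontinuous; (A1) $A_p\ne0$ and $\mathrm{Im}(A_p)\supseteq\{b\}\cup\mathrm{Im}(A_1)\cup\dots\cup\mathrm{Im}(A_{p-1})$; (A2) $f_p:\mathbb{R}^{n_p}\to\mathbb{R}$ is differentiable with $L_p$-Lipschitz gradient; (A3) there is $\bar\beta\ge0$ with $v(\bar\beta)>-\infty$, where $v(\beta):=\inf_{x}\{\sum_{i=1}^pf_i(x_i)+\frac\beta2\|\sum_{i=1}^pA_ix_i-b\|^2\}$. $\partial$ is the limiting (Mordukhovich) subdifferential; $A^*$ is the transpose; $\sigma^+_{A_p}$ is the smallest positive eigenvalue of $A_p^*A_p$. Distance generating functions: for $Z\subseteq\mathbb{R}^s$ and $0<m\le M$, $\mathcal{D}_Z(m,M)$ is the class of real-valued functions $w$ differentiable on $Z$ with $w(z')-w(z)-\langle\nabla w(z),z'-z\rangle\ge\frac m2\|z'-z\|^2$ and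 $\|\nabla w(z)-\nabla w(z')\|\le M\|z-z'\|$ for all $z,z'\in Z$; its Bregman distance is $(dw)_z(z'):=w(z')-w(z)-\langle\nabla w(z),z'-z\rangle$ for $z\in Z$, $z'\in\mathbb{R}^s$. NEPJ-ADMM: let $Z_i=\mathrm{dom} f_i$, $\gamma_\theta:=\theta/(1-|\theta-1|)^2$. Pick $(x_1^0,\dots,x_p^0,\lambda^0)\in Z_1\times\dots\times Z_p\times\mathbb{R}^d$, $\alpha>0$, $\beta\ge\bar\beta$ with $\beta>0$, $M_i\ge m_i>0$, $\theta\in(0,2)$ such that $\delta_i:=\frac{m_i}{4}-\big(\frac{p-2+\alpha}{2}+\frac{2\gamma_\theta(p+1)}{\sigma^+_{A_p}}\|A_p^*\|^2\big)\beta\max_{1\le l\le p-1}\|A_l\|^2>0$ for $i=1,\dots,p-1$ and $\delta_p:=\frac{m_p}{4}-\big(\frac{\beta(p-1)\|A_p\|^2}{2\alpha}+\frac{\gamma_\theta(p+1)(L_p^2+2M_p^2)}{\beta\sigma^+_{A_p}}\big)>0$. For $k\ge1$: for each $i$ choose $w_i^k\in\mathcal{D}_{Z_i}(m_i,M_i)$ and let $x_i^k$ be an optimal solution (assumed to exist) of $\min_{x_i}\{\mathcal{L}_\beta(x^{k-1}_{<i},x_i,x^{k-1}_{>i},\lambda^{k-1})+(dw_i^k)_{x_i^{k-1}}(x_i)\}$, where $(x_{<i},x_i,x_{>i})$ denotes $(x_1,\dots,x_p)$ with the $i$-th block singled out; then set $\lambda^k=\lambda^{k-1}-\theta\beta(\sum_{i=1}^pA_ix_i^k-b)$.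 Write $x^k=(x_1^k,\dots,x_p^k)$. Notation: $\hat\lambda^k:=\lambda^{k-1}-\beta(\sum_iA_ix_i^k-b)$; $\Delta x_i^k:=x_i^k-x_i^{k-1}$; $\Delta w_i^k:=\nabla w_i^k(x_i^k)-\nabla w_i^k(x_i^{k-1})$; $R_i^k:=-\sum_{j\ne i}\beta A_i^*A_j\Delta x_j^k+\Delta w_i^k$ for $k\ge1$. *)

theory Defs
  imports "Jordan_Normal_Form.Char_Poly" "HOL-Library.Extended_Real"
begin

definition vnorm :: "real vec \<Rightarrow> real" where
  "vnorm v = sqrt (v \<bullet> v)"

definition opnorm :: "real mat \<Rightarrow> real" where
  "opnorm A = Sup {vnorm (A *\<^sub>v x) | x. x \<in> carrier_vec (dim_col A) \<and> vnorm x \<le> 1}"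

definition sigma_plus :: "real mat \<Rightarrow> real" where
  "sigma_plus A = Min {k. eigenvalue (A\<^sup>T * A) k \<and> k > 0}"

definition has_grad :: "nat \<Rightarrow> (real vec \<Rightarrow> real) \<Rightarrow> real vec \<Rightarrow> real vec \<Rightarrow> bool" where
  "has_grad n F g x \<longleftrightarrow> x \<in> carrier_vec n \<and> g \<in> carrier_vec n \<and>
     (\<forall>\<epsilon>>0. \<exists>\<delta>>0. \<forall>y\<in>carrier_vec n. vnorm (y - x) < \<delta> \<longrightarrow>
        \<bar>F y - F x - g \<bullet> (y - x)\<bar> \<le> \<epsilon> * vnorm (y - x))"

definition proper_fun :: "nat \<Rightarrow> (real vec \<Rightarrow> ereal) \<Rightarrow> bool" where
  "proper_fun n F \<longleftrightarrow> (\<forall>x\<in>carrier_vec n. F x \<noteq> -\<infinity>) \<and> (\<exists>x\<in>carrier_vec n. F x \<noteq> \<infinity>)"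

definition lsc_fun :: "nat \<Rightarrow> (real vec \<Rightarrow> ereal) \<Rightarrow> bool" where
  "lsc_fun n F \<longleftrightarrow> (\<forall>x\<in>carrier_vec n. \<forall>c::real. ereal c < F x \<longrightarrow>
      (\<exists>\<delta>>0. \<forall>y\<in>carrier_vec n. vnorm (y - x) < \<delta> \<longrightarrow> ereal c < F y))"

definition edom :: "nat \<Rightarrow> (real vec \<Rightarrow> ereal) \<Rightarrow> real vec set" where
  "edom n F = {x \<in> carrier_vec n. F x < \<infinity>}"

definition frechet_subdiff :: "nat \<Rightarrow> (real vec \<Rightarrow> ereal) \<Rightarrow> real vec \<Rightarrow> real vec set" where
  "frechet_subdiff n F x = {v \<in> carrier_vec n. x \<in> carrier_vec n \<and> \<bar>F x\<bar> \<noteq> \<infinity> \<and>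
     (\<forall>\<epsilon>>0. \<exists>\<delta>>0. \<forall>y\<in>carrier_vec n. vnorm (y - x) < \<delta> \<longrightarrow>
        F y \<ge> F x + ereal (v \<bullet> (y - x) - \<epsilon> * vnorm (y - x)))}"

definition limiting_subdiff :: "nat \<Rightarrow> (real vec \<Rightarrow> ereal) \<Rightarrow> real vec \<Rightarrow> real vec set" where
  "limiting_subdiff n F x = {v \<in> carrier_vec n. x \<in> carrier_vec n \<and> \<bar>F x\<bar> \<noteq> \<infinity> \<and>
     (\<exists>xs vs :: nat \<Rightarrow> real vec.
        (\<forall>k. xs k \<in> carrier_vec n \<and> vs k \<in> frechet_subdiff n F (xs k)) \<and>
        (\<lambda>k. vnorm (xs k - x)) \<longlonglongrightarrow> 0 \<and>
        (\<lambda>k. F (xs k)) \<longlonglongrightarrow> F x \<and>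
        (\<lambda>k. vnorm (vs k - v)) \<longlonglongrightarrow> 0)}"

definition bregman :: "(real vec \<Rightarrow> real) \<Rightarrow> (real vec \<Rightarrow> real vec) \<Rightarrow> real vec \<Rightarrow> real vec \<Rightarrow> real" where
  "bregman w gw z z' = w z' - w z - gw z \<bullet> (z' - z)"

definition dgf_class :: "nat \<Rightarrow> real vec set \<Rightarrow> real \<Rightarrow> real \<Rightarrow> (real vec \<Rightarrow> real) \<Rightarrow> (real vec \<Rightarrow> real vec) \<Rightarrow> bool" where
  "dgf_class s Z m M w gw \<longleftrightarrow>
     (\<forall>z\<in>Z. has_grad s w (gw z) z) \<and>
     (\<forall>z\<in>Z. \<forall>z'\<in>Z. bregman w gw z z' \<ge> m / 2 * (vnorm (z' - z))\<^sup>2) \<and>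
     (\<forall>z\<in>Z. \<forall>z'\<in>Z. vnorm (gw z - gw z') \<le> M * vnorm (z - z'))"

definition resid :: "nat \<Rightarrow> nat \<Rightarrow> (nat \<Rightarrow> real mat) \<Rightarrow> real vec \<Rightarrow> (nat \<Rightarrow> real vec) \<Rightarrow> real vec" where
  "resid p d A b x = vec d (\<lambda>r. (\<Sum>i\<in>{1..p}. (A i *\<^sub>v x i) $ r) - b $ r)"

definition aug_lag :: "nat \<Rightarrow> nat \<Rightarrow> (nat \<Rightarrow> real vec \<Rightarrow> ereal) \<Rightarrow> (nat \<Rightarrow> real mat) \<Rightarrow> real vec
    \<Rightarrow> real \<Rightarrow> (nat \<Rightarrow> real vec) \<Rightarrow> real vec \<Rightarrow> ereal" where
  "aug_lag p d f A b \<beta> x lm = (\<Sum>i\<in>{1..p}. f i (x i)) - ereal (lm \<bullet> resid p d A b x)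
      + ereal (\<beta> / 2 * (vnorm (resid p d A b x))\<^sup>2)"

definition val_fun :: "nat \<Rightarrow> (nat \<Rightarrow> nat) \<Rightarrow> nat \<Rightarrow> (nat \<Rightarrow> real vec \<Rightarrow> ereal) \<Rightarrow> (nat \<Rightarrow> real mat) \<Rightarrow> real vec
    \<Rightarrow> real \<Rightarrow> ereal" where
  "val_fun p n d f A b \<beta> = (INF x \<in> {x. \<forall>i\<in>{1..p}. x i \<in> carrier_vec (n i)}.
      (\<Sum>i\<in>{1..p}. f i (x i)) + ereal (\<beta> / 2 * (vnorm (resid p d A b x))\<^sup>2))"

definition gamma_theta :: "real \<Rightarrow> real" where
  "gamma_theta \<theta> = \<theta> / (1 - \<bar>\<theta> - 1\<bar>)\<^sup>2"

definition delta_par :: "nat \<Rightarrow> (nat \<Rightarrow> real mat) \<Rightarrow> real \<Rightarrow> real \<Rightarrow> real \<Rightarrow> real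
    \<Rightarrow> (nat \<Rightarrow> real) \<Rightarrow> (nat \<Rightarrow> real) \<Rightarrow> nat \<Rightarrow> real" where
  "delta_par p A Lp \<alpha> \<beta> \<theta> m M i =
    (if i < p then
       m i / 4 - ((real p - 2 + \<alpha>) / 2 + 2 * gamma_theta \<theta> * (real p + 1) / sigma_plus (A p) * (opnorm ((A p)\<^sup>T))\<^sup>2)
                 * \<beta> * Max ((\<lambda>l. (opnorm (A l))\<^sup>2) ` {1..<p})
     else
       m p / 4 - (\<beta> * (real p - 1) * (opnorm (A p))\<^sup>2 / (2 * \<alpha>)
                 + gamma_theta \<theta> * (real p + 1) * (Lp\<^sup>2 + 2 * (M p)\<^sup>2) / (\<beta> * sigma_plus (A p))))"

end

(* The potential
     Phi_k = L_beta(x^k, lambda^k) + c |A_p^T (lambda^k - lambda^(k-1))|^2 + sum_i (m_i / 4) |Delta x_i^k|^2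
   with c = t / ((1 - t) beta theta sigma), t = |theta - 1|, decreases by
   sum_i delta_i (|Delta x_i^k|^2 + |Delta x_i^(k-1)|^2) per iteration.  The Jacobi step contributes the
   cross terms <A_i Delta x_i, A_j Delta x_j>, absorbed by the strong convexity of the w_i.  The multiplier
   step contributes |lambda^k - lambda^(k-1)|^2 / (beta theta); as the residual lies in Im A_p, this is at most
   |A_p^T (lambda^k - lambda^(k-1))|^2 / (sigma beta theta), and the p-th optimality condition expresses
   A_p^T lambda-hat^k by grad f_p and R_p^k.
   The potential stays above v(beta): the excess L_beta(x^k, lambda^k) - v(beta) is bounded below by the increment
   of |lambda|^2 / (2 beta theta), so its partial sums are bounded below, which a decreasing sequence that
   drops below v(beta) would violate.  Averaging the decrease gives the rate. *)

theory Submission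
  imports Defs "HOL-Analysis.Function_Topology" "HOL-Analysis.L2_Norm" "Jordan_Normal_Form.Spectral_Radius"
begin

section \<open>Euclidean vectors and operator norms\<close>

text \<open>Only the last block is smooth, so an equation, rather than an inclusion, is available
  for A_p^T lambda-hat^k alone. This is why multipliers are measured through A_p^T, with (A1)
  carrying the estimate back to lambda itself. The equation brings in \<Delta>x^k through R_p^k, so
  the increment of A_p^T lambda-hat involves \<Delta>x^(k-1) as well. Strong convexity supplies
  m_i/2 per block: half pays for the current step, half is stored in the potential to pay for the
  same increment when it returns as a lag. The number t is the contraction factor of the relaxed
  update lambda^k = (1 - \<theta>) lambda^(k-1) + \<theta> lambda-hat^k, valid also for
  over-relaxation \<theta> > 1. Convexity of the square, rearranged into telescoping form, costs a
  division by 1 - t; hence the stored coefficient t/(1 - t) and the factor \<theta>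
  \<gamma>_\<theta> = (\<theta>/(1 - t))^2.\<close>

lemma vnorm_eq_L2_set: "vnorm v = L2_set (\<lambda>i. v $ i) {0..<dim_vec v}"
  by (simp add: vnorm_def L2_set_def scalar_prod_def power2_eq_square)

lemma vnorm_nonneg [simp]: "0 \<le> vnorm v"
  by (simp add: vnorm_eq_L2_set)

lemma vnorm_power2: "(vnorm v)\<^sup>2 = v \<bullet> v"
  by (simp add: vnorm_def scalar_prod_def sum_nonneg)

lemma vnorm_zero [simp]: "vnorm (0\<^sub>v k) = 0"
  by (simp add: vnorm_def)

lemma vnorm_eq_0_iff: "v \<in> carrier_vec k \<Longrightarrow> vnorm v = 0 \<longleftrightarrow> v = 0\<^sub>v k"
  by (auto simp: vnorm_eq_L2_set L2_set_eq_0_iff intro!: eq_vecI)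

lemma vnorm_smult [simp]: "vnorm (c \<cdot>\<^sub>v v) = \<bar>c\<bar> * vnorm v"
  by (simp add: vnorm_def flip: real_sqrt_mult real_sqrt_abs)
    (simp add: power2_eq_square algebra_simps)

lemma abs_scalar_prod_le:
  assumes "u \<in> carrier_vec k" "v \<in> carrier_vec k"
  shows "\<bar>u \<bullet> v\<bar> \<le> vnorm u * vnorm v"
proof -
  have "\<bar>u \<bullet> v\<bar> \<le> (\<Sum>i\<in>{0..<k}. \<bar>u $ i\<bar> * \<bar>v $ i\<bar>)"
    using assms by (auto simp: scalar_prod_def simp flip: abs_mult intro: sum_abs)
  also have "\<dots> \<le> vnorm u * vnorm v"
    using L2_set_mult_ineq[of "\<lambda>i. u $ i" "\<lambda>i. v $ i" "{0..<k}"] assms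
    by (simp add: vnorm_eq_L2_set)
  finally show ?thesis .
qed

lemma vnorm_triangle:
  assumes "u \<in> carrier_vec k" "v \<in> carrier_vec k"
  shows "vnorm (u + v) \<le> vnorm u + vnorm v"
proof -
  have "vnorm (u + v) = L2_set (\<lambda>i. u $ i + v $ i) {0..<k}"
    using assms by (auto simp: vnorm_eq_L2_set intro!: L2_set_cong)
  then show ?thesis
    using L2_set_triangle_ineq[of "\<lambda>i. u $ i" "\<lambda>i. v $ i" "{0..<k}"] assms
    by (simp add: vnorm_eq_L2_set)
qed

lemma vnorm_add_power2:
  assumes "u \<in> carrier_vec k" "v \<in> carrier_vec k"
  shows "(vnorm (u + v))\<^sup>2 = (vnorm u)\<^sup>2 + 2 * (u \<bullet> v) + (vnorm v)\<^sup>2"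
  using assms unfolding vnorm_power2
  by (simp add: add_scalar_prod_distrib[of _ k] scalar_prod_add_distrib[of _ k] comm_scalar_prod[of v k u])

lemma vnorm_minus_power2_le:
  assumes "u \<in> carrier_vec k" "v \<in> carrier_vec k"
  shows "(vnorm (u - v))\<^sup>2 \<le> 2 * (vnorm u)\<^sup>2 + 2 * (vnorm v)\<^sup>2"
proof -
  have e: "u - v = u + (-1) \<cdot>\<^sub>v v" using assms by (intro eq_vecI) auto
  have "(vnorm (u - v))\<^sup>2 \<le> (vnorm u + vnorm v)\<^sup>2"
    using vnorm_triangle[of u k "(-1) \<cdot>\<^sub>v v"] assms by (intro power_mono) (auto simp: e)
  also have "\<dots> \<le> 2 * (vnorm u)\<^sup>2 + 2 * (vnorm v)\<^sup>2"
    using sum_squares_bound[of "vnorm u" "vnorm v"] by (simp add: power2_sum)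
  finally show ?thesis .
qed

text \<open>The length \<open>k\<close> is explicit so that the empty sum is the zero vector of the
  right dimension.\<close>

definition vsum :: "nat \<Rightarrow> ('i \<Rightarrow> real vec) \<Rightarrow> 'i set \<Rightarrow> real vec" where
  "vsum k g S = vec k (\<lambda>r. \<Sum>i\<in>S. g i $ r)"

lemma vsum_carrier [simp]: "vsum k g S \<in> carrier_vec k"
  by (simp add: vsum_def)

lemma vsum_index [simp]: "r < k \<Longrightarrow> vsum k g S $ r = (\<Sum>i\<in>S. g i $ r)"
  by (simp add: vsum_def)

lemma dim_vsum [simp]: "dim_vec (vsum k g S) = k"
  by (simp add: vsum_def)

lemma vsum_insert:
  assumes "finite S" "a \<notin> S" "g a \<in> carrier_vec k"
  shows "vsum k g (insert a S) = g a + vsum k g S"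
  using assms by (intro eq_vecI) auto

lemma vsum_empty [simp]: "vsum k g {} = 0\<^sub>v k"
  by (intro eq_vecI) auto

lemma scalar_prod_vsum:
  assumes "v \<in> carrier_vec k" "\<And>i. i \<in> S \<Longrightarrow> g i \<in> carrier_vec k"
  shows "v \<bullet> vsum k g S = (\<Sum>i\<in>S. v \<bullet> g i)"
proof -
  have "v \<bullet> vsum k g S = (\<Sum>r\<in>{0..<k}. \<Sum>i\<in>S. v $ r * g i $ r)"
    by (simp add: scalar_prod_def sum_distrib_left)
  also have "\<dots> = (\<Sum>i\<in>S. \<Sum>r\<in>{0..<k}. v $ r * g i $ r)"
    by (rule sum.swap)
  also have "\<dots> = (\<Sum>i\<in>S. v \<bullet> g i)"
    using assms by (intro sum.cong) (simp_all add: scalar_prod_def carrier_vecD[OF assms(2)])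
  finally show ?thesis .
qed

lemma mult_mat_vsum:
  assumes "B \<in> carrier_mat l k" "\<And>i. i \<in> S \<Longrightarrow> g i \<in> carrier_vec k"
  shows "B *\<^sub>v vsum k g S = vsum l (\<lambda>i. B *\<^sub>v g i) S"
  using assms by (intro eq_vecI) (auto simp: scalar_prod_vsum[of _ k])

lemma vnorm_vsum_le:
  assumes "finite S" "\<And>i. i \<in> S \<Longrightarrow> g i \<in> carrier_vec k"
  shows "vnorm (vsum k g S) \<le> (\<Sum>i\<in>S. vnorm (g i))"
  using assms
proof (induction S rule: finite_induct)
  case (insert a S)
  then show ?case
    using vnorm_triangle[of "g a" k "vsum k g S"] by (simp add: vsum_insert)
qed simp

lemma vnorm_vsum_power2_le:
  assumes "finite S" "\<And>i. i \<in> S \<Longrightarrow> g i \<in> carrier_vec k"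
  shows "(vnorm (vsum k g S))\<^sup>2 \<le> real (card S) * (\<Sum>i\<in>S. (vnorm (g i))\<^sup>2)"
proof -
  have "(vnorm (vsum k g S))\<^sup>2 \<le> (\<Sum>i\<in>S. vnorm (g i))\<^sup>2"
    using vnorm_vsum_le[OF assms] by (intro power_mono) auto
  also have "\<dots> \<le> (L2_set (\<lambda>i. vnorm (g i)) S * L2_set (\<lambda>_. 1) S)\<^sup>2"
    using L2_set_mult_ineq[of "\<lambda>i. vnorm (g i)" "\<lambda>_. 1" S]
    by (intro power_mono) (auto simp: sum_nonneg)
  also have "\<dots> = (\<Sum>i\<in>S. (vnorm (g i))\<^sup>2) * real (card S)"
    by (simp add: power_mult_distrib L2_set_def sum_nonneg)
  finally show ?thesis by (simp add: mult.commute)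
qed

text \<open>The Frobenius norm is a crude bound, applied row by row through Cauchy-Schwarz. It shows
  that the set in \<open>opnorm\<close> is bounded above, so that its \<open>Sup\<close> is a
  genuine least upper bound.\<close>

lemma vnorm_mult_mat_vec_le_rows:
  assumes "B \<in> carrier_mat l k" "x \<in> carrier_vec k"
  shows "vnorm (B *\<^sub>v x) \<le> sqrt (\<Sum>i\<in>{0..<l}. (vnorm (row B i))\<^sup>2) * vnorm x"
proof -
  have "(vnorm (B *\<^sub>v x))\<^sup>2 = (\<Sum>i\<in>{0..<l}. (row B i \<bullet> x)\<^sup>2)"
    using assms by (simp add: vnorm_power2) (simp add: scalar_prod_def power2_eq_square)
  also have "\<dots> \<le> (\<Sum>i\<in>{0..<l}. (vnorm (row B i) * vnorm x)\<^sup>2)"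
    using assms abs_scalar_prod_le[of _ k x]
    by (intro sum_mono) (metis abs_ge_zero power2_abs power_mono row_carrier_vec carrier_matD atLeastLessThan_iff)
  also have "\<dots> = (\<Sum>i\<in>{0..<l}. (vnorm (row B i))\<^sup>2) * (vnorm x)\<^sup>2"
    by (simp add: power_mult_distrib sum_distrib_right)
  finally show ?thesis
    by (metis real_le_rsqrt real_sqrt_mult real_sqrt_unique vnorm_nonneg)
qed

lemma bdd_above_vnorm_mult_mat_vec:
  "bdd_above {vnorm (B *\<^sub>v x) | x. x \<in> carrier_vec (dim_col B) \<and> vnorm x \<le> 1}"
proof (rule bdd_aboveI)
  fix s assume "s \<in> {vnorm (B *\<^sub>v x) | x. x \<in> carrier_vec (dim_col B) \<and> vnorm x \<le> 1}"
  then obtain y where y: "y \<in> carrier_vec (dim_col B)" "vnorm y \<le> 1" "s = vnorm (B *\<^sub>v y)" by auto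
  show "s \<le> sqrt (\<Sum>i\<in>{0..<dim_row B}. (vnorm (row B i))\<^sup>2)"
    using vnorm_mult_mat_vec_le_rows[of B "dim_row B" "dim_col B" y] y
      mult_left_mono[of "vnorm y" 1 "sqrt (\<Sum>i\<in>{0..<dim_row B}. (vnorm (row B i))\<^sup>2)"]
    by (auto simp: sum_nonneg intro: order_trans)
qed

lemma vnorm_mult_mat_vec_le:
  assumes "B \<in> carrier_mat l k" "x \<in> carrier_vec k"
  shows "vnorm (B *\<^sub>v x) \<le> opnorm B * vnorm x"
proof (cases "x = 0\<^sub>v k")
  case True
  then show ?thesis using assms vnorm_mult_mat_vec_le_rows[of B l k x] by simp
next
  case False
  have pos: "vnorm x > 0"
    using False assms vnorm_eq_0_iff[of x k] vnorm_nonneg[of x] by (simp add: less_le)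
  define y where "y = inverse (vnorm x) \<cdot>\<^sub>v x"
  have "vnorm (B *\<^sub>v y) \<le> opnorm B"
    unfolding opnorm_def using assms pos
    by (intro cSup_upper bdd_above_vnorm_mult_mat_vec)
      (auto simp: y_def intro!: exI[of _ "inverse (vnorm x) \<cdot>\<^sub>v x"])
  moreover have "B *\<^sub>v y = inverse (vnorm x) \<cdot>\<^sub>v (B *\<^sub>v x)"
    using assms unfolding y_def by (intro mult_mat_vec)
  ultimately show ?thesis using pos by (simp add: field_simps)
qed

lemma opnorm_nonneg: "0 \<le> opnorm B"
proof -
  have "vnorm (B *\<^sub>v 0\<^sub>v (dim_col B)) = 0"
    using vnorm_mult_mat_vec_le_rows[of B "dim_row B" "dim_col B" "0\<^sub>v (dim_col B)"]
    by (simp add: antisym)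
  then show ?thesis
    unfolding opnorm_def
    by (intro cSup_upper2[OF _ _ bdd_above_vnorm_mult_mat_vec, of 0])
      (force intro: exI[of _ "0\<^sub>v (dim_col B)"])+
qed

section \<open>The smallest positive eigenvalue\<close>

text \<open>Compactness is obtained in the product topology on
  \<open>nat \<Rightarrow> real\<close>. A vector is read as its coordinate function, set to 0 from
  index \<open>d\<close> on; unit vectors then lie in the box \<open>Bx\<close>, compact by
  Tychonoff. The sphere and the orthogonality conditions are closed, since they involve finitely
  many coordinates each.\<close>

lemma min_on_unit_sphere_of_annihilator:
  fixes N :: "real vec set"
  assumes B: "B \<in> carrier_mat k d"
    and y0: "y0 \<in> carrier_vec d" "vnorm y0 = 1" "\<forall>z\<in>N. y0 \<bullet> z = 0" and N: "N \<subseteq> carrier_vec d"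
  obtains y where "y \<in> carrier_vec d" "vnorm y = 1" "\<forall>z\<in>N. y \<bullet> z = 0"
    "\<And>z. z \<in> carrier_vec d \<Longrightarrow> vnorm z = 1 \<Longrightarrow> \<forall>u\<in>N. z \<bullet> u = 0
      \<Longrightarrow> (vnorm (B *\<^sub>v y))\<^sup>2 \<le> (vnorm (B *\<^sub>v z))\<^sup>2"
proof -
  define Bx :: "(nat \<Rightarrow> real) set" where "Bx = PiE UNIV (\<lambda>i. if i < d then {-1..1} else {0})"
  define K where "K = Bx \<inter> (\<Inter>z\<in>N. {f. (\<Sum>i\<in>{0..<d}. f i * z $ i) = 0})
    \<inter> {f. (\<Sum>i\<in>{0..<d}. f i * f i) = 1}"
  define h where "h = (\<lambda>f::nat \<Rightarrow> real. \<Sum>r\<in>{0..<k}. (\<Sum>i\<in>{0..<d}. row B r $ i * f i)\<^sup>2)"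
  have "compactin (product_topology (\<lambda>i. euclidean) UNIV) Bx"
    unfolding Bx_def by (subst compactin_PiE) auto
  then have "compact Bx" by (simp add: euclidean_product_topology)
  moreover have cont: "continuous_on UNIV (\<lambda>f::nat \<Rightarrow> real. f i)" for i by simp
  have "closed {f::nat \<Rightarrow> real. (\<Sum>i\<in>{0..<d}. f i * z $ i) = 0}" for z :: "real vec"
    by (intro closed_Collect_eq continuous_intros cont)
  moreover have "closed {f::nat \<Rightarrow> real. (\<Sum>i\<in>{0..<d}. f i * f i) = 1}"
    by (intro closed_Collect_eq continuous_intros cont)
  ultimately have cK: "compact K"
    unfolding K_def by (intro compact_Int_closed closed_INT) auto
  have hcont: "continuous_on K h"
    unfolding h_def by (intro continuous_intros continuous_on_subset[OF cont]) auto
  have toK: "(\<lambda>i. if i < d then z $ i else 0) \<in> K \<and> h (\<lambda>i. if i < d then z $ i else 0) = (vnorm (B *\<^sub>v z))\<^sup>2"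
    if z: "z \<in> carrier_vec d" "vnorm z = 1" "\<forall>u\<in>N. z \<bullet> u = 0" for z
  proof
    have s1: "(\<Sum>i\<in>{0..<d}. z $ i * z $ i) = 1"
      using z(1,2) vnorm_power2[of z] by (simp add: scalar_prod_def)
    have "\<bar>z $ i\<bar> \<le> 1" if "i < d" for i
    proof -
      have "(z $ i)\<^sup>2 \<le> (\<Sum>i\<in>{0..<d}. z $ i * z $ i)"
        using member_le_sum[of i "{0..<d}" "\<lambda>i. z $ i * z $ i"] that by (simp add: power2_eq_square)
      then show ?thesis using s1 by (simp add: abs_square_le_1)
    qed
    then have "(\<lambda>i. if i < d then z $ i else 0) \<in> Bx"
      by (auto simp: Bx_def abs_le_iff)
    moreover have "(\<Sum>i\<in>{0..<d}. z $ i * u $ i) = 0" if "u \<in> N" for u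
      using z(3) N that by (auto simp: scalar_prod_def subset_iff dest!: carrier_vecD)
    ultimately show "(\<lambda>i. if i < d then z $ i else 0) \<in> K"
      using s1 by (auto simp: K_def)
    show "h (\<lambda>i. if i < d then z $ i else 0) = (vnorm (B *\<^sub>v z))\<^sup>2"
      using z(1) B by (simp add: h_def vnorm_power2)
        (simp add: scalar_prod_def power2_eq_square)
  qed
  from toK[OF y0] have "K \<noteq> {}" by blast
  from continuous_attains_inf[OF cK this hcont] obtain f where f: "f \<in> K" "\<forall>g\<in>K. h f \<le> h g" by blast
  define y where "y = vec d f"
  have y: "y \<in> carrier_vec d" by (simp add: y_def)
  have ny: "vnorm y = 1"
    using f by (simp add: y_def vnorm_def scalar_prod_def K_def)
  have oy: "\<forall>z\<in>N. y \<bullet> z = 0"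
    using f N by (auto simp: y_def scalar_prod_def K_def subset_iff dest!: carrier_vecD)
  have hf: "h f = (vnorm (B *\<^sub>v y))\<^sup>2"
    using B by (simp add: h_def y_def vnorm_power2) (simp add: scalar_prod_def power2_eq_square)
  show ?thesis
    using that[OF y ny oy] f(2) toK hf by metis
qed

text \<open>For nonzero a the linear term would win near 0: at t = -a/(|c| + 1) the expression is at
  most -(a/(|c| + 1))^2. The summand 1 keeps the denominator positive when c = 0.\<close>

lemma real_linear_term_zero:
  fixes a c :: real
  assumes "\<And>t. 0 \<le> t * a + t\<^sup>2 * c"
  shows "a = 0"
proof (rule ccontr)
  assume a: "a \<noteq> 0"
  define t where "t = - a / (\<bar>c\<bar> + 1)"
  have "t * a + t\<^sup>2 * c \<le> t * a + t\<^sup>2 * \<bar>c\<bar>" by (simp add: mult_left_mono)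
  also have "\<dots> = (a / (\<bar>c\<bar> + 1))\<^sup>2 * (\<bar>c\<bar> - (\<bar>c\<bar> + 1))"
    by (simp add: t_def power2_eq_square divide_simps) (simp add: algebra_simps)
  also have "\<dots> < 0" using a by (simp add: add_nonneg_eq_0_iff)
  finally show False using assms[of t] by simp
qed

text \<open>A minimiser \<open>y\<close> of \<open>\<parallel>A\<^sup>T y\<parallel>\<^sup>2\<close> on the unit sphere of the orthogonal complement of \<open>ker A\<^sup>T\<close>
  satisfies \<open>A A\<^sup>T y = \<mu> y\<close> with \<open>\<mu> > 0\<close>, so \<open>A\<^sup>T y\<close> is an eigenvector of \<open>A\<^sup>T A\<close> for \<open>\<mu>\<close>;
  this replaces the spectral theorem.\<close>

lemma sigma_plus_props:
  assumes A: "A \<in> carrier_mat d k" and nz: "A \<noteq> 0\<^sub>m d k"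
  shows "0 < sigma_plus A"
    and "\<And>x. x \<in> carrier_vec k \<Longrightarrow>
      sigma_plus A * (vnorm (A *\<^sub>v x))\<^sup>2 \<le> (vnorm (A\<^sup>T *\<^sub>v (A *\<^sub>v x)))\<^sup>2"
proof -
  have At: "A\<^sup>T \<in> carrier_mat k d" using A by simp
  have adj: "(A\<^sup>T *\<^sub>v y) \<bullet> x = y \<bullet> (A *\<^sub>v x)" if "x \<in> carrier_vec k" "y \<in> carrier_vec d" for x y
    using transpose_vec_mult_scalar[OF A that] .
  \<comment> \<open>\<open>V\<close> is the orthogonal complement of the kernel of A^T. It contains
    Im A, so a lower bound for A^T on \<open>V\<close> gives the second claim.\<close>
  define N where "N = {z \<in> carrier_vec d. A\<^sup>T *\<^sub>v z = 0\<^sub>v k}"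
  define V where "V = {y \<in> carrier_vec d. \<forall>z\<in>N. y \<bullet> z = 0}"
  have N: "N \<subseteq> carrier_vec d" by (auto simp: N_def)
  have V: "V \<subseteq> carrier_vec d" by (auto simp: V_def)
  have ImV: "A *\<^sub>v x \<in> V" if x: "x \<in> carrier_vec k" for x
  proof -
    have "(A *\<^sub>v x) \<bullet> z = 0" if "z \<in> N" for z
      using adj[OF x, of z] that x A comm_scalar_prod[of "A *\<^sub>v x" d z]
      by (auto simp: N_def)
    then show ?thesis using x A by (auto simp: V_def)
  qed
  have Vsm: "c \<cdot>\<^sub>v y \<in> V" if "y \<in> V" for c y
    using that N by (auto simp: V_def subset_iff)
  have Vadd: "y + z \<in> V" if "y \<in> V" "z \<in> V" for y z
    using that N by (auto simp: V_def subset_iff add_scalar_prod_distrib[of _ d])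
  have Vmin: "y - z \<in> V" if "y \<in> V" "z \<in> V" for y z
    using that N by (auto simp: V_def subset_iff minus_scalar_prod_distrib[of _ d])
  obtain x0 where x0: "x0 \<in> carrier_vec k" "A *\<^sub>v x0 \<noteq> 0\<^sub>v d"
  proof -
    have "\<exists>i j. i < d \<and> j < k \<and> A $$ (i, j) \<noteq> 0"
      using A nz by (metis carrier_matD eq_matI index_zero_mat)
    then obtain i j where ij: "i < d" "j < k" "A $$ (i, j) \<noteq> 0" by blast
    then have "(A *\<^sub>v unit_vec k j) $ i \<noteq> 0" using A by simp
    then have "A *\<^sub>v unit_vec k j \<noteq> 0\<^sub>v d" using ij by auto
    then show ?thesis using that[of "unit_vec k j"] by simp
  qed
  have n0: "vnorm (A *\<^sub>v x0) \<noteq> 0" using x0 A vnorm_eq_0_iff[of "A *\<^sub>v x0" d] by simp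
  define y0 where "y0 = inverse (vnorm (A *\<^sub>v x0)) \<cdot>\<^sub>v (A *\<^sub>v x0)"
  have y0V: "y0 \<in> V" unfolding y0_def using ImV x0 Vsm by blast
  have y0n: "vnorm y0 = 1" using n0 by (simp add: y0_def)
  obtain y where y: "y \<in> carrier_vec d" "vnorm y = 1" "\<forall>z\<in>N. y \<bullet> z = 0"
    and ymin: "\<And>z. z \<in> carrier_vec d \<Longrightarrow> vnorm z = 1 \<Longrightarrow> \<forall>u\<in>N. z \<bullet> u = 0
      \<Longrightarrow> (vnorm (A\<^sup>T *\<^sub>v y))\<^sup>2 \<le> (vnorm (A\<^sup>T *\<^sub>v z))\<^sup>2"
    using min_on_unit_sphere_of_annihilator[OF At, of y0 N] y0V y0n N unfolding V_def by blast
  have yV: "y \<in> V" using y by (simp add: V_def)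
  define \<mu> where "\<mu> = (vnorm (A\<^sup>T *\<^sub>v y))\<^sup>2"
  have \<mu>0: "\<mu> > 0"
  proof -
    have "A\<^sup>T *\<^sub>v y \<noteq> 0\<^sub>v k"
    proof
      assume "A\<^sup>T *\<^sub>v y = 0\<^sub>v k"
      then have "y \<in> N" using y by (simp add: N_def)
      then have "y \<bullet> y = 0" using y by blast
      then show False using y(2) by (simp add: vnorm_def)
    qed
    then show ?thesis
      using vnorm_eq_0_iff[of "A\<^sup>T *\<^sub>v y" k] y At by (simp add: \<mu>_def)
  qed
  have low: "\<mu> * (vnorm z)\<^sup>2 \<le> (vnorm (A\<^sup>T *\<^sub>v z))\<^sup>2" if z: "z \<in> V" for z
  proof (cases "vnorm z = 0")
    case False
    define u where "u = inverse (vnorm z) \<cdot>\<^sub>v z"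
    have "u \<in> V" using Vsm z by (simp add: u_def)
    moreover have "vnorm u = 1" using False by (simp add: u_def)
    ultimately have "\<mu> \<le> (vnorm (A\<^sup>T *\<^sub>v u))\<^sup>2"
      using ymin[of u] by (auto simp: V_def \<mu>_def)
    also have "A\<^sup>T *\<^sub>v u = inverse (vnorm z) \<cdot>\<^sub>v (A\<^sup>T *\<^sub>v z)"
      using z V At unfolding u_def by (intro mult_mat_vec) auto
    finally show ?thesis using False
      by (simp add: power_mult_distrib field_simps)
  qed simp
  \<comment> \<open>The bound \<open>low\<close> at y + t z is an equality at t = 0, because y is a
    unit vector. The resulting quadratic in t therefore has no constant term, and nonnegativity
    forces its linear coefficient to vanish.\<close>
  have stat: "(A\<^sup>T *\<^sub>v y) \<bullet> (A\<^sup>T *\<^sub>v z) = \<mu> * (y \<bullet> z)" if z: "z \<in> V" for z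
  proof -
    have zc: "z \<in> carrier_vec d" using z V by blast
    define a where "a = 2 * ((A\<^sup>T *\<^sub>v y) \<bullet> (A\<^sup>T *\<^sub>v z) - \<mu> * (y \<bullet> z))"
    define c where "c = (vnorm (A\<^sup>T *\<^sub>v z))\<^sup>2 - \<mu> * (vnorm z)\<^sup>2"
    have "0 \<le> t * a + t\<^sup>2 * c" for t
    proof -
      have "\<mu> * (vnorm (y + t \<cdot>\<^sub>v z))\<^sup>2 \<le> (vnorm (A\<^sup>T *\<^sub>v (y + t \<cdot>\<^sub>v z)))\<^sup>2"
        using low Vadd Vsm z yV by blast
      moreover have "A\<^sup>T *\<^sub>v (y + t \<cdot>\<^sub>v z) = A\<^sup>T *\<^sub>v y + t \<cdot>\<^sub>v (A\<^sup>T *\<^sub>v z)"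
        using y zc At by (simp add: mult_add_distrib_mat_vec[OF At] mult_mat_vec[OF At])
      ultimately show ?thesis
        using y zc At vnorm_add_power2[of y d "t \<cdot>\<^sub>v z"] vnorm_add_power2[of "A\<^sup>T *\<^sub>v y" k "t \<cdot>\<^sub>v (A\<^sup>T *\<^sub>v z)"]
          scalar_prod_smult_distrib[of y d z t] scalar_prod_smult_distrib[of "A\<^sup>T *\<^sub>v y" k "A\<^sup>T *\<^sub>v z" t]
        by (simp add: a_def c_def \<mu>_def[symmetric] algebra_simps power_mult_distrib)
    qed
    then have "a = 0" by (rule real_linear_term_zero)
    then show ?thesis by (simp add: a_def)
  qed
  define x where "x = A\<^sup>T *\<^sub>v y"
  have xc: "x \<in> carrier_vec k" using At y by (simp add: x_def)
  have Ax: "A *\<^sub>v x = \<mu> \<cdot>\<^sub>v y"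
  proof -
    \<comment> \<open>Stationarity can be tested only against elements of \<open>V\<close>; the
      defect \<open>e\<close> lies in \<open>V\<close>, so it can be tested against itself.\<close>
    define e where "e = A *\<^sub>v x - \<mu> \<cdot>\<^sub>v y"
    have eV: "e \<in> V" unfolding e_def using ImV xc Vsm yV Vmin by blast
    then have ec: "e \<in> carrier_vec d" using V by blast
    have "(A *\<^sub>v x) \<bullet> e = x \<bullet> (A\<^sup>T *\<^sub>v e)"
      using adj[OF xc ec] comm_scalar_prod[of x k "A\<^sup>T *\<^sub>v e"] comm_scalar_prod[of "A *\<^sub>v x" d e] xc ec A At
      by simp
    also have "\<dots> = \<mu> * (y \<bullet> e)" using stat[OF eV] by (simp add: x_def)
    finally have "e \<bullet> e = 0"
      using ec y xc A minus_scalar_prod_distrib[of "A *\<^sub>v x" d "\<mu> \<cdot>\<^sub>v y" e]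
      by (simp add: e_def[symmetric])
    then have "e = 0\<^sub>v d" using vnorm_eq_0_iff[OF ec] by (simp add: vnorm_def)
    then have "e $ i = 0" if "i < d" for i using that by simp
    then show ?thesis
      using y xc A unfolding e_def by (intro eq_vecI) auto
  qed
  have "eigenvector (A\<^sup>T * A) x \<mu>"
  proof -
    have "x \<noteq> 0\<^sub>v k" using \<mu>0 by (auto simp: \<mu>_def x_def)
    moreover have "A\<^sup>T * A *\<^sub>v x = \<mu> \<cdot>\<^sub>v x"
      using A At xc y by (simp add: assoc_mult_mat_vec[of _ k d _ k] Ax mult_mat_vec[OF At]) (simp add: x_def)
    ultimately show ?thesis using xc A by (simp add: eigenvector_def)
  qed
  then have mem: "\<mu> \<in> {e. eigenvalue (A\<^sup>T * A) e \<and> e > 0}"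
    using \<mu>0 by (auto simp: eigenvalue_def)
  have fin: "finite {e. eigenvalue (A\<^sup>T * A) e \<and> e > 0}"
    using card_finite_spectrum(1)[of "A\<^sup>T * A" k] A At
    by (auto simp: spectrum_def intro: finite_subset[of _ "Collect (eigenvalue (A\<^sup>T * A))"])
  show "0 < sigma_plus A"
    unfolding sigma_plus_def using Min_in[OF fin] mem by blast
  have le: "sigma_plus A \<le> \<mu>" unfolding sigma_plus_def using Min_le[OF fin mem] .
  show "sigma_plus A * (vnorm (A *\<^sub>v x))\<^sup>2 \<le> (vnorm (A\<^sup>T *\<^sub>v (A *\<^sub>v x)))\<^sup>2" if "x \<in> carrier_vec k" for x
    using low[OF ImV[OF that]] mult_right_mono[OF le, of "(vnorm (A *\<^sub>v x))\<^sup>2"] by simp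
qed

section \<open>Subdifferentials, residuals and convexity estimates\<close>

text \<open>Near the minimiser the quadratic term is o(|y - x|) and w is linear up to such an error,
  so only the slopes c and g survive. One half of \<epsilon> absorbs C |y - x|^2, the other the
  linearisation error of w.\<close>

lemma minimizer_frechet_subdiff:
  assumes x: "x \<in> carrier_vec n" and c: "c \<in> carrier_vec n" and fin: "\<bar>F x\<bar> \<noteq> \<infinity>"
    and grad: "has_grad n w g x" and C: "C \<ge> 0"
    and min: "\<And>y. y \<in> carrier_vec n \<Longrightarrow>
      F x \<le> F y + ereal (c \<bullet> (y - x) + C * (vnorm (y - x))\<^sup>2 + (w y - w x))"
  shows "(-1) \<cdot>\<^sub>v (c + g) \<in> frechet_subdiff n F x"
proof -
  have g: "g \<in> carrier_vec n" using grad by (simp add: has_grad_def)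
  have "\<exists>\<delta>>0. \<forall>y\<in>carrier_vec n. vnorm (y - x) < \<delta> \<longrightarrow>
    F y \<ge> F x + ereal (((-1) \<cdot>\<^sub>v (c + g)) \<bullet> (y - x) - \<epsilon> * vnorm (y - x))" if e: "\<epsilon> > 0" for \<epsilon>
  proof -
    obtain \<delta>1 where d1: "\<delta>1 > 0" and
      gd: "\<And>y. y \<in> carrier_vec n \<Longrightarrow> vnorm (y - x) < \<delta>1 \<Longrightarrow>
        \<bar>w y - w x - g \<bullet> (y - x)\<bar> \<le> \<epsilon> / 2 * vnorm (y - x)"
      using grad e unfolding has_grad_def by (metis half_gt_zero)
    define \<delta> where "\<delta> = min \<delta>1 (\<epsilon> / (2 * (C + 1)))"
    have "\<delta> > 0" using d1 e C by (simp add: \<delta>_def)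
    moreover have "F y \<ge> F x + ereal (((-1) \<cdot>\<^sub>v (c + g)) \<bullet> (y - x) - \<epsilon> * vnorm (y - x))"
      if y: "y \<in> carrier_vec n" and d: "vnorm (y - x) < \<delta>" for y
    proof -
      let ?h = "vnorm (y - x)"
      have "C * ?h\<^sup>2 \<le> \<epsilon> / 2 * ?h"
      proof -
        have "C * ?h \<le> (C + 1) * (\<epsilon> / (2 * (C + 1)))"
          using d C by (intro mult_mono) (auto simp: \<delta>_def)
        also have "\<dots> = \<epsilon> / 2" using C by (simp add: field_simps)
        finally show ?thesis
          using mult_right_mono[of "C * ?h" "\<epsilon> / 2" ?h] by (simp add: power2_eq_square mult.assoc)
      qed
      moreover have "w y - w x - g \<bullet> (y - x) \<le> \<epsilon> / 2 * ?h"
        using order_trans[OF abs_ge_self gd[OF y]] d by (simp add: \<delta>_def)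
      moreover have "((-1) \<cdot>\<^sub>v (c + g)) \<bullet> (y - x) = - (c \<bullet> (y - x)) - g \<bullet> (y - x)"
        using c g x y by (simp add: smult_scalar_prod_distrib[of _ n] add_scalar_prod_distrib[of _ n])
      ultimately have "((-1) \<cdot>\<^sub>v (c + g)) \<bullet> (y - x) - \<epsilon> * ?h
          \<le> - (c \<bullet> (y - x) + C * ?h\<^sup>2 + (w y - w x))" by simp
      moreover obtain r where r: "F x = ereal r" using fin by auto
      ultimately show ?thesis using min[OF y] by (cases "F y") auto
    qed
    ultimately show ?thesis by blast
  qed
  then show ?thesis using x c g fin by (simp add: frechet_subdiff_def)
qed

text \<open>Moving from x in the direction u = v - g, the subgradient inequality and
  differentiability together give t |u|^2 \<le> \<epsilon> t |u|, for every \<epsilon> > 0.\<close>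

lemma frechet_subdiff_eq_grad:
  assumes v: "v \<in> frechet_subdiff n F x" and fin: "\<And>y. y \<in> carrier_vec n \<Longrightarrow> \<bar>F y\<bar> \<noteq> \<infinity>"
    and grad: "has_grad n (\<lambda>y. real_of_ereal (F y)) g x"
  shows "v = g"
proof -
  have x: "x \<in> carrier_vec n" and g: "g \<in> carrier_vec n" and vc: "v \<in> carrier_vec n"
    using grad v by (auto simp: has_grad_def frechet_subdiff_def)
  define u where "u = v - g"
  have u: "u \<in> carrier_vec n" using g vc by (simp add: u_def)
  have "vnorm u \<le> \<epsilon>" if e: "\<epsilon> > 0" for \<epsilon>
  proof (rule ccontr)
    assume "\<not> vnorm u \<le> \<epsilon>"
    then have uu: "vnorm u > \<epsilon>" by simp
    obtain \<delta>1 where d1: "\<delta>1 > 0" and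
      1: "\<And>y. y \<in> carrier_vec n \<Longrightarrow> vnorm (y - x) < \<delta>1 \<Longrightarrow>
        \<bar>real_of_ereal (F y) - real_of_ereal (F x) - g \<bullet> (y - x)\<bar> \<le> \<epsilon> / 2 * vnorm (y - x)"
      using grad e unfolding has_grad_def by (metis half_gt_zero)
    obtain \<delta>2 where d2: "\<delta>2 > 0" and
      2: "\<And>y. y \<in> carrier_vec n \<Longrightarrow> vnorm (y - x) < \<delta>2 \<Longrightarrow>
        F y \<ge> F x + ereal (v \<bullet> (y - x) - \<epsilon> / 2 * vnorm (y - x))"
      using v half_gt_zero[OF e] unfolding frechet_subdiff_def by blast
    \<comment> \<open>Chosen so that the displacement has length min \<delta>1 \<delta>2 / 2, inside
      both neighbourhoods.\<close>
    define t where "t = min \<delta>1 \<delta>2 / (2 * vnorm u)"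
    have t: "t > 0" using d1 d2 uu e by (simp add: t_def)
    define y where "y = x + t \<cdot>\<^sub>v u"
    have y: "y \<in> carrier_vec n" using x u by (simp add: y_def)
    have yx: "y - x = t \<cdot>\<^sub>v u" using x u by (intro eq_vecI) (auto simp: y_def)
    have "vnorm (y - x) = min \<delta>1 \<delta>2 / 2" using t uu e by (simp add: yx) (simp add: t_def)
    then have small: "vnorm (y - x) < \<delta>1" "vnorm (y - x) < \<delta>2" using d1 d2 by auto
    obtain a b where ab: "F x = ereal a" "F y = ereal b" using fin[OF x] fin[OF y] by auto
    have "v \<bullet> (y - x) - \<epsilon> / 2 * vnorm (y - x) \<le> g \<bullet> (y - x) + \<epsilon> / 2 * vnorm (y - x)"
      using order_trans[OF abs_ge_self 1[OF y small(1)]] 2[OF y small(2)] by (simp add: ab)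
    moreover have "v \<bullet> (y - x) - g \<bullet> (y - x) = t * (vnorm u)\<^sup>2"
      using vc g u minus_scalar_prod_distrib[of v n g "y - x"]
      by (simp add: yx vnorm_power2 u_def[symmetric])
    moreover have "vnorm (y - x) = t * vnorm u" using t by (simp add: yx)
    ultimately have "t * (vnorm u)\<^sup>2 \<le> \<epsilon> * (t * vnorm u)" by simp
    then have "vnorm u * (t * vnorm u) \<le> \<epsilon> * (t * vnorm u)" by (simp add: power2_eq_square ac_simps)
    moreover have "t * vnorm u > 0" using t uu e by simp
    ultimately show False using uu by (simp only: mult_le_cancel_right_pos)
  qed
  then have "vnorm u \<le> 0" by (meson field_le_epsilon le_add_same_cancel2 order_trans dense_ge)
  then have "u = 0\<^sub>v n" using vnorm_eq_0_iff[OF u] by (simp add: antisym)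
  then have "u $ i = 0" if "i < n" for i using that by simp
  then show ?thesis using vc g unfolding u_def by (intro eq_vecI) auto
qed

lemma frechet_subdiff_subset_limiting: "frechet_subdiff n F x \<subseteq> limiting_subdiff n F x"
proof
  fix v assume v: "v \<in> frechet_subdiff n F x"
  have c: "v \<in> carrier_vec n" "x \<in> carrier_vec n" "\<bar>F x\<bar> \<noteq> \<infinity>"
    using v by (auto simp: frechet_subdiff_def)
  have "v - v = 0\<^sub>v n" "x - x = 0\<^sub>v n" using c by auto
  then show "v \<in> limiting_subdiff n F x"
    using c v unfolding limiting_subdiff_def
    by (intro CollectI conjI exI[of _ "\<lambda>_. x"] exI[of _ "\<lambda>_. v"]) simp_all
qed

section \<open>The constraint residual as an affine function of the blocks\<close>

lemma resid_carrier [simp]: "resid p d A b x \<in> carrier_vec d"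
  by (simp add: resid_def)

lemma dim_resid [simp]: "dim_vec (resid p d A b x) = d"
  by (simp add: resid_def)

lemma resid_eq_add_vsum:
  assumes A: "\<And>i. i \<in> {1..p} \<Longrightarrow> A i \<in> carrier_mat d (n i)"
    and x: "\<And>i. i \<in> {1..p} \<Longrightarrow> x i \<in> carrier_vec (n i)"
    and y: "\<And>i. i \<in> {1..p} \<Longrightarrow> y i \<in> carrier_vec (n i)"
  shows "resid p d A b y = resid p d A b x + vsum d (\<lambda>i. A i *\<^sub>v (y i - x i)) {1..p}"
proof (rule eq_vecI)
  fix r assume "r < dim_vec (resid p d A b x + vsum d (\<lambda>i. A i *\<^sub>v (y i - x i)) {1..p})"
  then have r: "r < d" by simp
  have "(A i *\<^sub>v (y i - x i)) $ r = (A i *\<^sub>v y i) $ r - (A i *\<^sub>v x i) $ r" if "i \<in> {1..p}" for i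
    using r A[OF that] x[OF that] y[OF that]
    by (subst mult_minus_distrib_mat_vec[of _ d "n i"]) auto
  then show "resid p d A b y $ r
      = (resid p d A b x + vsum d (\<lambda>i. A i *\<^sub>v (y i - x i)) {1..p}) $ r"
    using r by (simp add: resid_def sum_subtractf)
qed simp

lemma resid_fun_upd:
  assumes A: "\<And>i. i \<in> {1..p} \<Longrightarrow> A i \<in> carrier_mat d (n i)"
    and x: "\<And>i. i \<in> {1..p} \<Longrightarrow> x i \<in> carrier_vec (n i)"
    and i: "i \<in> {1..p}" and y: "y \<in> carrier_vec (n i)"
  shows "resid p d A b (x(i := y)) = resid p d A b x + A i *\<^sub>v (y - x i)"
proof -
  have "vsum d (\<lambda>j. A j *\<^sub>v ((x(i := y)) j - x j)) {1..p} = A i *\<^sub>v (y - x i)"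
  proof (rule eq_vecI)
    fix r assume "r < dim_vec (A i *\<^sub>v (y - x i))"
    then have r: "r < d" using A[OF i] by simp
    have "(A j *\<^sub>v ((x(i := y)) j - x j)) $ r = (if j = i then (A i *\<^sub>v (y - x i)) $ r else 0)"
      if "j \<in> {1..p}" for j
    proof (cases "j = i")
      case False
      have "x j - x j = 0\<^sub>v (n j)" using x[OF that] by simp
      then show ?thesis using False r A[OF that] by simp
    qed simp
    then show "vsum d (\<lambda>j. A j *\<^sub>v ((x(i := y)) j - x j)) {1..p} $ r = (A i *\<^sub>v (y - x i)) $ r"
      using r i by simp
  qed (use A[OF i] in simp)
  then show ?thesis
    using resid_eq_add_vsum[of p A d n x "x(i := y)" b] A x y by simp
qed

lemma aug_lag_ereal:
  assumes "\<And>i. i \<in> {1..p} \<Longrightarrow> f i (x i) = ereal (g i)"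
  shows "aug_lag p d f A b \<beta> x lm
    = ereal ((\<Sum>i\<in>{1..p}. g i) - lm \<bullet> resid p d A b x + \<beta> / 2 * (vnorm (resid p d A b x))\<^sup>2)"
proof -
  have "(\<Sum>i\<in>{1..p}. f i (x i)) = ereal (\<Sum>i\<in>{1..p}. g i)"
    using assms by (simp flip: sum_ereal)
  then show ?thesis by (simp add: aug_lag_def)
qed

text \<open>With t = |\<theta> - 1| and B = \<theta> |b| / (1 - t), the triangle inequality bounds
  the norm by the convex combination t |a| + (1 - t) B, and the square is convex. Passing to norms
  first lets one argument cover \<theta> > 1, where 1 - \<theta> is negative.\<close>

lemma convex_combination_power2_le:
  fixes a b :: "real vec"
  assumes a: "a \<in> carrier_vec k" and b: "b \<in> carrier_vec k" and th: "0 < \<theta>" "\<theta> < 2"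
  shows "(vnorm ((1 - \<theta>) \<cdot>\<^sub>v a + \<theta> \<cdot>\<^sub>v b))\<^sup>2
    \<le> \<bar>\<theta> - 1\<bar> * (vnorm a)\<^sup>2 + \<theta>\<^sup>2 / (1 - \<bar>\<theta> - 1\<bar>) * (vnorm b)\<^sup>2"
proof -
  define t where "t = \<bar>\<theta> - 1\<bar>"
  define B where "B = \<theta> * vnorm b / (1 - t)"
  have t: "0 \<le> t" "t < 1" using th by (auto simp: t_def)
  have "vnorm ((1 - \<theta>) \<cdot>\<^sub>v a + \<theta> \<cdot>\<^sub>v b) \<le> t * vnorm a + (1 - t) * B"
    using vnorm_triangle[of "(1 - \<theta>) \<cdot>\<^sub>v a" k "\<theta> \<cdot>\<^sub>v b"] a b th t
    by (simp add: t_def B_def abs_minus_commute)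
  then have "(vnorm ((1 - \<theta>) \<cdot>\<^sub>v a + \<theta> \<cdot>\<^sub>v b))\<^sup>2 \<le> (t * vnorm a + (1 - t) * B)\<^sup>2"
    by (intro power_mono) auto
  also have "\<dots> = t * (vnorm a)\<^sup>2 + (1 - t) * B\<^sup>2 - t * (1 - t) * (vnorm a - B)\<^sup>2"
    by (simp add: power2_eq_square algebra_simps)
  also have "\<dots> \<le> t * (vnorm a)\<^sup>2 + (1 - t) * B\<^sup>2" using t by simp
  also have "(1 - t) * B\<^sup>2 = \<theta>\<^sup>2 / (1 - t) * (vnorm b)\<^sup>2"
    unfolding B_def power_divide power_mult_distrib using t by (simp add: power2_eq_square)
  finally show ?thesis by (simp add: t_def)
qed

text \<open>Cauchy-Schwarz among the members of S, and Young's inequality with weight \<alpha> for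
  each pair with the distinguished index a. The parameter \<alpha> of the method thus shifts the
  cost of the coupling between the last block and the others.\<close>

lemma vnorm_vsum_insert_power2_le:
  assumes S: "finite S" "a \<notin> S" "S \<noteq> {}" and g: "\<And>i. i \<in> insert a S \<Longrightarrow> g i \<in> carrier_vec k"
    and \<alpha>: "\<alpha> > 0"
  shows "(vnorm (vsum k g (insert a S)))\<^sup>2
    \<le> (real (card S) + \<alpha>) * (\<Sum>i\<in>S. (vnorm (g i))\<^sup>2) + (1 + real (card S) / \<alpha>) * (vnorm (g a))\<^sup>2"
proof -
  have young: "2 * (g a \<bullet> g i) \<le> \<alpha> * (vnorm (g i))\<^sup>2 + (vnorm (g a))\<^sup>2 / \<alpha>" if "i \<in> S" for i
  proof -
    have "g a \<bullet> g i \<le> vnorm (g a) * vnorm (g i)"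
      using abs_scalar_prod_le[of "g a" k "g i"] g that by auto
    moreover have "0 \<le> (\<alpha> * vnorm (g i) - vnorm (g a))\<^sup>2 / \<alpha>" using \<alpha> by simp
    then have "2 * (vnorm (g a) * vnorm (g i)) \<le> \<alpha> * (vnorm (g i))\<^sup>2 + (vnorm (g a))\<^sup>2 / \<alpha>"
      using \<alpha> by (simp add: power2_eq_square field_simps)
    ultimately show ?thesis by simp
  qed
  have "2 * (g a \<bullet> vsum k g S) = (\<Sum>i\<in>S. 2 * (g a \<bullet> g i))"
    using g by (subst scalar_prod_vsum[of _ k]) (auto simp: sum_distrib_left)
  also have "\<dots> \<le> (\<Sum>i\<in>S. \<alpha> * (vnorm (g i))\<^sup>2 + (vnorm (g a))\<^sup>2 / \<alpha>)"
    by (intro sum_mono young)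
  also have "\<dots> = \<alpha> * (\<Sum>i\<in>S. (vnorm (g i))\<^sup>2) + real (card S) / \<alpha> * (vnorm (g a))\<^sup>2"
    by (simp add: sum.distrib sum_distrib_left)
  finally show ?thesis
    using vnorm_vsum_power2_le[OF S(1), of g k] g
      vnorm_add_power2[of "g a" k "vsum k g S"] vsum_insert[of S a g k] S
    by (simp add: algebra_simps)
qed

lemma sum_ereal_eq_PInf:
  fixes g :: "'i \<Rightarrow> ereal"
  assumes "finite S" "\<And>j. j \<in> S \<Longrightarrow> g j \<noteq> -\<infinity>" "i \<in> S" "g i = \<infinity>"
  shows "sum g S = \<infinity>"
  using assms by (simp add: sum_Pinfty) blast

section \<open>One iteration of the method\<close>

text \<open>(A3) is assumed at the working penalty \<beta>; the theorem derives this from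
  \<beta>bar, as \<open>val_fun\<close> is monotone in the penalty.\<close>

locale nepj_admm =
  fixes p d :: nat and n :: "nat \<Rightarrow> nat"
    and f :: "nat \<Rightarrow> real vec \<Rightarrow> ereal" and A :: "nat \<Rightarrow> real mat" and b :: "real vec"
    and gp :: "real vec \<Rightarrow> real vec" and Lp :: real
    and \<alpha> \<beta> \<theta> :: real and m M :: "nat \<Rightarrow> real"
    and xs :: "nat \<Rightarrow> nat \<Rightarrow> real vec" and lam :: "nat \<Rightarrow> real vec"
    and w :: "nat \<Rightarrow> nat \<Rightarrow> real vec \<Rightarrow> real" and gw :: "nat \<Rightarrow> nat \<Rightarrow> real vec \<Rightarrow> real vec"
  assumes p2: "p \<ge> 2"
    and A_dim: "\<And>i. i \<in> {1..p} \<Longrightarrow> A i \<in> carrier_mat d (n i)"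
    and b_dim: "b \<in> carrier_vec d"
    and f_proper: "\<And>i. i \<in> {1..<p} \<Longrightarrow> proper_fun (n i) (f i)"
    and A1_nz: "A p \<noteq> 0\<^sub>m d (n p)"
    and A1_b: "\<exists>y\<in>carrier_vec (n p). A p *\<^sub>v y = b"
    and A1_im: "\<And>i x. i \<in> {1..<p} \<Longrightarrow> x \<in> carrier_vec (n i) \<Longrightarrow>
      \<exists>y\<in>carrier_vec (n p). A p *\<^sub>v y = A i *\<^sub>v x"
    and A2_real: "\<And>x. x \<in> carrier_vec (n p) \<Longrightarrow> \<bar>f p x\<bar> \<noteq> \<infinity>"
    and A2_grad: "\<And>x. x \<in> carrier_vec (n p) \<Longrightarrow> has_grad (n p) (\<lambda>y. real_of_ereal (f p y)) (gp x) x"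
    and A2_lip: "\<And>x y. x \<in> carrier_vec (n p) \<Longrightarrow> y \<in> carrier_vec (n p) \<Longrightarrow>
      vnorm (gp x - gp y) \<le> Lp * vnorm (x - y)"
    and A3: "val_fun p n d f A b \<beta> > -\<infinity>"
    and x0: "\<And>i. i \<in> {1..p} \<Longrightarrow> xs 0 i \<in> edom (n i) (f i)"
    and lam0: "lam 0 \<in> carrier_vec d"
    and \<alpha>_pos: "\<alpha> > 0" and \<beta>_pos: "\<beta> > 0"
    and mM: "\<And>i. i \<in> {1..p} \<Longrightarrow> 0 < m i \<and> m i \<le> M i"
    and theta: "0 < \<theta>" "\<theta> < 2"
    and delta_pos: "\<And>i. i \<in> {1..p} \<Longrightarrow> delta_par p A Lp \<alpha> \<beta> \<theta> m M i > 0"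
    and w_class: "\<And>k i. k \<ge> 1 \<Longrightarrow> i \<in> {1..p} \<Longrightarrow>
      dgf_class (n i) (edom (n i) (f i)) (m i) (M i) (w k i) (gw k i)"
    and xs_carrier_Suc: "\<And>k i. k \<ge> 1 \<Longrightarrow> i \<in> {1..p} \<Longrightarrow> xs k i \<in> carrier_vec (n i)"
    and x_step: "\<And>k i y. k \<ge> 1 \<Longrightarrow> i \<in> {1..p} \<Longrightarrow> y \<in> carrier_vec (n i) \<Longrightarrow>
      aug_lag p d f A b \<beta> ((xs (k - 1))(i := xs k i)) (lam (k - 1))
        + ereal (bregman (w k i) (gw k i) (xs (k - 1) i) (xs k i))
      \<le> aug_lag p d f A b \<beta> ((xs (k - 1))(i := y)) (lam (k - 1))
        + ereal (bregman (w k i) (gw k i) (xs (k - 1) i) y)"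
    and lam_step: "\<And>k. k \<ge> 1 \<Longrightarrow> lam k = lam (k - 1) - (\<theta> * \<beta>) \<cdot>\<^sub>v resid p d A b (xs k)"
begin

abbreviation "\<delta> \<equiv> delta_par p A Lp \<alpha> \<beta> \<theta> m M"
abbreviation "res k \<equiv> resid p d A b (xs k)"
abbreviation "F i x \<equiv> real_of_ereal (f i x)"
abbreviation "dx k i \<equiv> xs k i - xs (k - 1) i"
abbreviation "adx k i \<equiv> A i *\<^sub>v dx k i"

section \<open>Iterates stay in the effective domains\<close>

lemma xs0_carrier: "i \<in> {1..p} \<Longrightarrow> xs 0 i \<in> carrier_vec (n i)"
  using x0 by (auto simp: edom_def)

lemma xs_carrier [simp]: "i \<in> {1..p} \<Longrightarrow> xs k i \<in> carrier_vec (n i)"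
  using xs0_carrier xs_carrier_Suc by (cases k) auto

lemma adx_carrier [simp]:
  assumes "i \<in> {1..p}"
  shows "A i *\<^sub>v (xs k i - xs l i) \<in> carrier_vec d"
  using assms by (intro mult_mat_vec_carrier[OF A_dim]) auto

lemma lam_carrier [simp]: "lam k \<in> carrier_vec d"
proof (induction k)
  case (Suc k)
  then show ?case using lam_step[of "Suc k"] by simp
qed (simp add: lam0)

lemma dim_lam [simp]: "dim_vec (lam k) = d"
  by (rule carrier_vecD) simp

lemma dim_xs: "i \<in> {1..p} \<Longrightarrow> dim_vec (xs k i) = n i"
  by (rule carrier_vecD) simp

lemma At_dim: "i \<in> {1..p} \<Longrightarrow> (A i)\<^sup>T \<in> carrier_mat (n i) d"
  using A_dim by simp

lemma f_ne_MInf: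
  assumes "i \<in> {1..p}" "x \<in> carrier_vec (n i)"
  shows "f i x \<noteq> -\<infinity>"
proof (cases "i = p")
  case True
  then show ?thesis using A2_real[of x] assms by auto
next
  case False
  then show ?thesis using f_proper[of i] assms by (auto simp: proper_fun_def)
qed

text \<open>The old block is a competitor in the subproblem with finite objective, by induction for
  all blocks at once. An infinite value at the new block would make the optimal objective infinite,
  since no other block is -\<infinity> and the Bregman term is real.\<close>

lemma f_xs_finite: "i \<in> {1..p} \<Longrightarrow> \<bar>f i (xs k i)\<bar> \<noteq> \<infinity>"
proof (induction k arbitrary: i)
  case 0
  then show ?case using x0[of i] f_ne_MInf[of i "xs 0 i"] by (auto simp: edom_def)
next
  case (Suc k)
  note i = Suc.prems
  have fin: "f j (xs k j) = ereal (F j (xs k j))" if "j \<in> {1..p}" for j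
    using Suc.IH[OF that] by (simp add: ereal_real)
  have "f i (xs (Suc k) i) \<noteq> \<infinity>"
  proof
    assume inf: "f i (xs (Suc k) i) = \<infinity>"
    have "(\<Sum>j\<in>{1..p}. f j (((xs k)(i := xs (Suc k) i)) j)) = \<infinity>"
      using i inf by (intro sum_ereal_eq_PInf[of _ _ i]) (auto simp: f_ne_MInf)
    then have "aug_lag p d f A b \<beta> ((xs k)(i := xs (Suc k) i)) (lam k) = \<infinity>"
      by (simp add: aug_lag_def)
    then show False
      using x_step[of "Suc k" i "xs k i"] i aug_lag_ereal[of p f "xs k" "\<lambda>j. F j (xs k j)" d A b \<beta> "lam k"] fin
      by simp
  qed
  then show ?case using f_ne_MInf[of i "xs (Suc k) i"] i by auto
qed

lemma f_xs: "i \<in> {1..p} \<Longrightarrow> f i (xs k i) = ereal (F i (xs k i))"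
  using f_xs_finite[of i k] by (simp add: ereal_real)

lemma xs_edom: "i \<in> {1..p} \<Longrightarrow> xs k i \<in> edom (n i) (f i)"
  using f_xs_finite[of i k] by (auto simp: edom_def)

lemma gw_xs_carrier:
  assumes "k \<ge> 1" "i \<in> {1..p}"
  shows "gw k i (xs l i) \<in> carrier_vec (n i)"
  using w_class[OF assms] xs_edom[OF assms(2)] by (auto simp: dgf_class_def has_grad_def)

text \<open>Expanding the residual about x^(k-1) splits the subproblem objective into the constant
  \<open>C\<close>, which cancels, and a part that depends on the block value alone.\<close>

lemma step_real:
  assumes k: "k \<ge> 1" and i: "i \<in> {1..p}" and y: "y \<in> carrier_vec (n i)" and fin: "\<bar>f i y\<bar> \<noteq> \<infinity>"
  defines "q \<equiv> (\<lambda>y. A i *\<^sub>v (y - xs (k - 1) i))"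
  defines "G \<equiv> (\<lambda>y. F i y - lam (k - 1) \<bullet> q y + \<beta> * (res (k - 1) \<bullet> q y) + \<beta> / 2 * (vnorm (q y))\<^sup>2
      + bregman (w k i) (gw k i) (xs (k - 1) i) y)"
  shows "G (xs k i) \<le> G y"
proof -
  let ?x = "xs (k - 1)" and ?r = "res (k - 1)" and ?l = "lam (k - 1)"
  define C where "C = (\<Sum>j\<in>{1..p} - {i}. F j (?x j)) - ?l \<bullet> ?r + \<beta> / 2 * (vnorm ?r)\<^sup>2"
  have 1: "aug_lag p d f A b \<beta> (?x(i := z)) ?l + ereal (bregman (w k i) (gw k i) (?x i) z) = ereal (C + G z)"
    if z: "z \<in> carrier_vec (n i)" and "\<bar>f i z\<bar> \<noteq> \<infinity>" for z
  proof -
    have q: "q z \<in> carrier_vec d"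
      unfolding q_def using z i by (intro mult_mat_vec_carrier[OF A_dim[OF i]]) simp
    have "f j ((?x(i := z)) j) = ereal (F j ((?x(i := z)) j))" if "j \<in> {1..p}" for j
      using that f_xs[OF that, of "k - 1"] \<open>\<bar>f i z\<bar> \<noteq> \<infinity>\<close> by (auto simp: ereal_real)
    then have "aug_lag p d f A b \<beta> (?x(i := z)) ?l
      = ereal ((\<Sum>j\<in>{1..p}. F j ((?x(i := z)) j)) - ?l \<bullet> resid p d A b (?x(i := z))
        + \<beta> / 2 * (vnorm (resid p d A b (?x(i := z))))\<^sup>2)"
      by (intro aug_lag_ereal)
    moreover have "resid p d A b (?x(i := z)) = ?r + q z"
      unfolding q_def using resid_fun_upd[of p A d n ?x i z b] A_dim i z by simp
    moreover have "(\<Sum>j\<in>{1..p}. F j ((?x(i := z)) j)) = F i z + (\<Sum>j\<in>{1..p} - {i}. F j (?x j))"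
      using i by (subst sum.remove[of _ i]) auto
    ultimately show ?thesis
      using q by (simp add: C_def G_def vnorm_add_power2[of _ d] scalar_prod_add_distrib[of _ d] algebra_simps)
  qed
  show ?thesis
    using x_step[OF k i y] 1[OF y fin] 1[of "xs k i"] i f_xs_finite[of i k] by simp
qed

section \<open>Optimality conditions of the block subproblems\<close>

definition lamh :: "nat \<Rightarrow> real vec" where
  "lamh k = lam (k - 1) - \<beta> \<cdot>\<^sub>v res k"

definition Rv :: "nat \<Rightarrow> nat \<Rightarrow> real vec" where
  "Rv k i = (gw k i (xs k i) - gw k i (xs (k - 1) i))
     - \<beta> \<cdot>\<^sub>v vsum (n i) (\<lambda>j. (A i)\<^sup>T *\<^sub>v adx k j) ({1..p} - {i})"

lemma lamh_carrier [simp]: "lamh k \<in> carrier_vec d"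
  by (simp add: lamh_def)

lemma dim_lamh [simp]: "dim_vec (lamh k) = d"
  by (rule carrier_vecD) simp

lemma Rv_carrier [simp]: "Rv k i \<in> carrier_vec (n i)"
  unfolding Rv_def by (intro carrier_vecI) simp

lemma dim_Rv [simp]: "dim_vec (Rv k i) = n i"
  by (rule carrier_vecD) simp

lemma res_step: "res k = res (k - 1) + vsum d (adx k) {1..p}"
  by (rule resid_eq_add_vsum[where n = n]) (auto simp: A_dim)

text \<open>In the i-th subproblem only block i has moved, so the gradient of the augmented term
  sees the old residual plus the i-th increment. Replacing this by the full new residual, which is
  what lambda-hat contains, leaves the increments of the other blocks as an error; they form R_i
  together with the difference of the gradients of w.\<close>

lemma optimality:
  assumes k: "k \<ge> 1" and i: "i \<in> {1..p}"
  shows "(A i)\<^sup>T *\<^sub>v lamh k - Rv k i \<in> frechet_subdiff (n i) (f i) (xs k i)"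
proof -
  let ?At = "(A i)\<^sup>T" and ?x = "xs k i" and ?z = "xs (k - 1) i" and ?l = "lam (k - 1)" and ?r = "res (k - 1)"
  let ?s = "vsum d (adx k) ({1..p} - {i})"
  note At = At_dim[OF i]
  \<comment> \<open>The derivative of the multiplier and penalty terms with respect to the residual,
    at the point where only block i is updated.\<close>
  define u where "u = \<beta> \<cdot>\<^sub>v (?r + adx k i) - ?l"
  define c where "c = ?At *\<^sub>v u - gw k i ?z"
  have gz: "gw k i ?z \<in> carrier_vec (n i)" and gx: "gw k i ?x \<in> carrier_vec (n i)"
    using gw_xs_carrier[OF k i] by auto
  have u: "u \<in> carrier_vec d" using adx_carrier[OF i, of k "k - 1"] by (simp add: u_def)
  have c: "c \<in> carrier_vec (n i)" using At u gz by (simp add: c_def)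
  have grad: "has_grad (n i) (w k i) (gw k i ?x) ?x"
    using w_class[OF k i] xs_edom[OF i] by (auto simp: dgf_class_def)
  have min: "f i ?x \<le> f i y + ereal (c \<bullet> (y - ?x) + \<beta> / 2 * (opnorm (A i))\<^sup>2 * (vnorm (y - ?x))\<^sup>2
      + (w k i y - w k i ?x))" if y: "y \<in> carrier_vec (n i)" for y
  proof (cases "\<bar>f i y\<bar> = \<infinity>")
    case True
    then have "f i y = \<infinity>" using f_ne_MInf[OF i y] by auto
    then show ?thesis by simp
  next
    case False
    define h where "h = A i *\<^sub>v (y - ?x)"
    have h: "h \<in> carrier_vec d"
      unfolding h_def using y i by (intro mult_mat_vec_carrier[OF A_dim[OF i]]) simp
    have e1: "A i *\<^sub>v (y - ?z) = adx k i + h"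
    proof -
      have "y - ?z = dx k i + (y - ?x)" using y dim_xs[OF i] by (intro eq_vecI) auto
      then show ?thesis unfolding h_def
        using y i by (simp add: mult_add_distrib_mat_vec[OF A_dim[OF i]])
    qed
    have e2: "gw k i ?z \<bullet> (y - ?z) = gw k i ?z \<bullet> dx k i + gw k i ?z \<bullet> (y - ?x)"
    proof -
      have "y - ?z = dx k i + (y - ?x)" using y dim_xs[OF i] by (intro eq_vecI) auto
      then show ?thesis using y i gz by (simp add: scalar_prod_add_distrib[of _ "n i"])
    qed
    have e3: "c \<bullet> (y - ?x) = \<beta> * (?r \<bullet> h) + \<beta> * (adx k i \<bullet> h) - ?l \<bullet> h - gw k i ?z \<bullet> (y - ?x)"
    proof -
      have "c \<bullet> (y - ?x) = (?At *\<^sub>v u) \<bullet> (y - ?x) - gw k i ?z \<bullet> (y - ?x)"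
        unfolding c_def using At u gz y i by (intro minus_scalar_prod_distrib[of _ "n i"]) auto
      also have "(?At *\<^sub>v u) \<bullet> (y - ?x) = u \<bullet> h"
        unfolding h_def using u y i by (intro transpose_vec_mult_scalar[OF A_dim[OF i]]) auto
      also have "u \<bullet> h = \<beta> * (?r \<bullet> h) + \<beta> * (adx k i \<bullet> h) - ?l \<bullet> h"
        unfolding u_def using h i adx_carrier[OF i, of k "k - 1"]
        by (simp add: minus_scalar_prod_distrib[of _ d] add_scalar_prod_distrib[of _ d]
              smult_scalar_prod_distrib[of _ d] algebra_simps)
      finally show ?thesis by simp
    qed
    have "\<beta> / 2 * (vnorm h)\<^sup>2 \<le> \<beta> / 2 * (opnorm (A i) * vnorm (y - ?x))\<^sup>2"
      unfolding h_def using \<beta>_pos y i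
      by (intro mult_left_mono power_mono vnorm_mult_mat_vec_le[OF A_dim[OF i]]) auto
    then have "F i ?x \<le> F i y + (c \<bullet> (y - ?x) + \<beta> / 2 * (opnorm (A i))\<^sup>2 * (vnorm (y - ?x))\<^sup>2
      + (w k i y - w k i ?x))"
      using step_real[OF k i y False] h adx_carrier[OF i, of k "k - 1"]
      unfolding e1 e3 bregman_def e2
      by (simp add: scalar_prod_add_distrib[of _ d] vnorm_add_power2[of _ d] power_mult_distrib
          add_divide_distrib algebra_simps)
    then show ?thesis
      using False f_xs_finite[OF i, of k] by (cases "f i y"; cases "f i (xs k i)") auto
  qed
  have "(-1) \<cdot>\<^sub>v (c + gw k i ?x) \<in> frechet_subdiff (n i) (f i) ?x"
    using minimizer_frechet_subdiff[OF _ c f_xs_finite[OF i] grad _ min] i \<beta>_pos by simp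
  also have "(-1) \<cdot>\<^sub>v (c + gw k i ?x) = ?At *\<^sub>v lamh k - Rv k i"
  proof -
    have "{1..p} = insert i ({1..p} - {i})" using i by auto
    then have "vsum d (adx k) {1..p} = adx k i + ?s"
      using vsum_insert[of "{1..p} - {i}" i "adx k" d] i by simp
    then have "res k = (?r + adx k i) + ?s"
      using res_step[of k] i by (simp add: assoc_add_vec[of _ d])
    then have u': "u = \<beta> \<cdot>\<^sub>v res k - \<beta> \<cdot>\<^sub>v ?s - ?l"
      unfolding u_def using carrier_vecD[OF adx_carrier[OF i, of k "k - 1"]]
      by (intro eq_vecI) (auto simp: algebra_simps)
    have Atu: "?At *\<^sub>v u = \<beta> \<cdot>\<^sub>v (?At *\<^sub>v res k) - \<beta> \<cdot>\<^sub>v (?At *\<^sub>v ?s) - ?At *\<^sub>v ?l"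
      unfolding u' by (simp add: mult_minus_distrib_mat_vec[OF At] mult_mat_vec[OF At])
    have Atl: "?At *\<^sub>v lamh k = ?At *\<^sub>v ?l - \<beta> \<cdot>\<^sub>v (?At *\<^sub>v res k)"
      unfolding lamh_def by (simp add: mult_minus_distrib_mat_vec[OF At] mult_mat_vec[OF At])
    have Ats: "?At *\<^sub>v ?s = vsum (n i) (\<lambda>j. ?At *\<^sub>v adx k j) ({1..p} - {i})"
      by (rule mult_mat_vsum[OF At]) auto
    show ?thesis
      unfolding c_def Rv_def Atu Atl Ats using carrier_vecD[OF gz] carrier_vecD[OF gx] carrier_matD[OF At]
      by (intro eq_vecI) (auto simp: algebra_simps)
  qed
  finally show ?thesis .
qed

lemma gp_eq:
  assumes k: "k \<ge> 1"
  shows "(A p)\<^sup>T *\<^sub>v lamh k - Rv k p = gp (xs k p)"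
proof (rule frechet_subdiff_eq_grad)
  have "p \<in> {1..p}" using p2 by simp
  then show "(A p)\<^sup>T *\<^sub>v lamh k - Rv k p \<in> frechet_subdiff (n p) (f p) (xs k p)"
    "has_grad (n p) (\<lambda>y. F p y) (gp (xs k p)) (xs k p)"
    using optimality[OF k] A2_grad by auto
qed (use A2_real in auto)

text \<open>Each block inequality moves one block from the common point x^(k-1), so their sum
  contains the sum of the |A_i \<Delta>x_i|^2, whereas the new point needs the square of the summed
  increments. The difference is the price of updating in parallel.\<close>

lemma primal_descent:
  assumes k: "k \<ge> 1"
  shows "(\<Sum>i\<in>{1..p}. F i (xs k i)) - lam (k - 1) \<bullet> res k + \<beta> / 2 * (vnorm (res k))\<^sup>2
    \<le> (\<Sum>i\<in>{1..p}. F i (xs (k - 1) i)) - lam (k - 1) \<bullet> res (k - 1) + \<beta> / 2 * (vnorm (res (k - 1)))\<^sup>2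
      - (\<Sum>i\<in>{1..p}. m i / 2 * (vnorm (dx k i))\<^sup>2)
      + \<beta> / 2 * ((real p - 2 + \<alpha>) * (\<Sum>i\<in>{1..<p}. (vnorm (adx k i))\<^sup>2) + (real p - 1) / \<alpha> * (vnorm (adx k p))\<^sup>2)"
proof -
  let ?l = "lam (k - 1)" and ?r = "res (k - 1)" and ?a = "vsum d (adx k) {1..p}"
  have 1: "F i (xs k i) - ?l \<bullet> adx k i + \<beta> * (?r \<bullet> adx k i) + \<beta> / 2 * (vnorm (adx k i))\<^sup>2
      + m i / 2 * (vnorm (dx k i))\<^sup>2 \<le> F i (xs (k - 1) i)" if i: "i \<in> {1..p}" for i
  proof -
    have z: "xs (k - 1) i - xs (k - 1) i = 0\<^sub>v (n i)" using i by simp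
    have z': "A i *\<^sub>v 0\<^sub>v (n i) = 0\<^sub>v d" using A_dim[OF i] by (intro eq_vecI) auto
    have g: "gw k i (xs (k - 1) i) \<bullet> 0\<^sub>v (n i) = 0"
      using gw_xs_carrier[OF k i] by (intro scalar_prod_right_zero)
    have "m i / 2 * (vnorm (dx k i))\<^sup>2 \<le> bregman (w k i) (gw k i) (xs (k - 1) i) (xs k i)"
      using w_class[OF k i] xs_edom[OF i] unfolding dgf_class_def by blast
    moreover have "bregman (w k i) (gw k i) (xs (k - 1) i) (xs (k - 1) i) = 0"
      unfolding bregman_def z g by simp
    ultimately show ?thesis
      using step_real[OF k i xs_carrier[OF i] f_xs_finite[OF i], of "k - 1"] unfolding z z' by simp
  qed
  have la: "?l \<bullet> ?a = (\<Sum>i\<in>{1..p}. ?l \<bullet> adx k i)" and ra: "?r \<bullet> ?a = (\<Sum>i\<in>{1..p}. ?r \<bullet> adx k i)"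
    by (rule scalar_prod_vsum; simp)+
  have "(\<Sum>i\<in>{1..p}. F i (xs k i) - ?l \<bullet> adx k i + \<beta> * (?r \<bullet> adx k i) + \<beta> / 2 * (vnorm (adx k i))\<^sup>2
      + m i / 2 * (vnorm (dx k i))\<^sup>2) \<le> (\<Sum>i\<in>{1..p}. F i (xs (k - 1) i))"
    by (intro sum_mono 1)
  then have 2: "(\<Sum>i\<in>{1..p}. F i (xs k i)) - ?l \<bullet> ?a + \<beta> * (?r \<bullet> ?a)
      + \<beta> / 2 * (\<Sum>i\<in>{1..p}. (vnorm (adx k i))\<^sup>2) + (\<Sum>i\<in>{1..p}. m i / 2 * (vnorm (dx k i))\<^sup>2)
      \<le> (\<Sum>i\<in>{1..p}. F i (xs (k - 1) i))"
    unfolding la ra by (simp add: sum.distrib sum_subtractf sum_distrib_left)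
  have ins: "{1..p} = insert p {1..<p}" using p2 by auto
  have "(vnorm ?a)\<^sup>2 \<le> (real (card {1..<p}) + \<alpha>) * (\<Sum>i\<in>{1..<p}. (vnorm (adx k i))\<^sup>2)
      + (1 + real (card {1..<p}) / \<alpha>) * (vnorm (adx k p))\<^sup>2"
    unfolding ins using p2 \<alpha>_pos by (intro vnorm_vsum_insert_power2_le) auto
  moreover have "(\<Sum>i\<in>{1..p}. (vnorm (adx k i))\<^sup>2) = (\<Sum>i\<in>{1..<p}. (vnorm (adx k i))\<^sup>2) + (vnorm (adx k p))\<^sup>2"
    unfolding ins by simp
  \<comment> \<open>Removing one copy of every square turns p - 1 + \<alpha> into p - 2 + \<alpha>
    and 1 + (p - 1)/\<alpha> into (p - 1)/\<alpha>, the constants of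
    \<open>delta_par\<close>.\<close>
  ultimately have "(vnorm ?a)\<^sup>2 - (\<Sum>i\<in>{1..p}. (vnorm (adx k i))\<^sup>2)
      \<le> (real p - 2 + \<alpha>) * (\<Sum>i\<in>{1..<p}. (vnorm (adx k i))\<^sup>2) + (real p - 1) / \<alpha> * (vnorm (adx k p))\<^sup>2"
    using p2 by (simp add: algebra_simps of_nat_diff)
  then have 3: "\<beta> / 2 * (vnorm ?a)\<^sup>2 - \<beta> / 2 * (\<Sum>i\<in>{1..p}. (vnorm (adx k i))\<^sup>2)
      \<le> \<beta> / 2 * ((real p - 2 + \<alpha>) * (\<Sum>i\<in>{1..<p}. (vnorm (adx k i))\<^sup>2) + (real p - 1) / \<alpha> * (vnorm (adx k p))\<^sup>2)"
    using \<beta>_pos by (simp flip: right_diff_distrib)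
  have 4: "?l \<bullet> res k = ?l \<bullet> ?r + ?l \<bullet> ?a"
    by (subst res_step) (simp add: scalar_prod_add_distrib[of _ d])
  have 5: "(vnorm (res k))\<^sup>2 = (vnorm ?r)\<^sup>2 + 2 * (?r \<bullet> ?a) + (vnorm ?a)\<^sup>2"
    by (subst res_step) (simp add: vnorm_add_power2[of _ d])
  have 6: "\<beta> / 2 * (vnorm (res k))\<^sup>2 = \<beta> / 2 * (vnorm ?r)\<^sup>2 + \<beta> * (?r \<bullet> ?a) + \<beta> / 2 * (vnorm ?a)\<^sup>2"
    unfolding 5 by (simp add: algebra_simps)
  show ?thesis using 2 3 4 6 by linarith
qed


section \<open>Multiplier increments seen through the transpose of the last matrix\<close>

abbreviation "\<sigma> \<equiv> sigma_plus (A p)"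
abbreviation "\<gamma> \<equiv> gamma_theta \<theta>"
abbreviation "amax \<equiv> Max ((\<lambda>l. (opnorm (A l))\<^sup>2) ` {1..<p})"
abbreviation "At \<equiv> (A p)\<^sup>T"
abbreviation "dlm k \<equiv> lam k - lam (k - 1)"

text \<open>At \<open>k = 0\<close> the initial dual residual plays the role of the Bregman term \<open>\<Delta>w\<^sub>p\<close>; this makes
  the recursion below hold from the first step on.\<close>

definition err :: "nat \<Rightarrow> real vec" where
  "err k = (if k = 0 then At *\<^sub>v lam 0 - gp (xs 0 p) else gw k p (xs k p) - gw k p (xs (k - 1) p))"

text \<open>A_p^T lambda-hat^k, with lambda^0 standing in for lambda-hat^0.\<close>

definition U :: "nat \<Rightarrow> real vec" where
  "U k = (if k = 0 then At *\<^sub>v lam 0 else At *\<^sub>v lamh k)"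

text \<open>By truncated subtraction \<open>dx 0 i\<close> is zero, so at k = 0 only the last block
  can carry a value. Dividing by M_p^2 there keeps the bound |err|^2 \<le> M_p^2 sq valid at k = 0,
  and m_p/4 times this value is eta_0.\<close>

definition sq :: "nat \<Rightarrow> nat \<Rightarrow> real" where
  "sq k i = (if k = 0 \<and> i = p then (vnorm (err 0))\<^sup>2 / (M p)\<^sup>2 else (vnorm (dx k i))\<^sup>2)"

lemma p_in [simp]: "p \<in> {1..p}" "Suc 0 \<le> p" "0 < p" "p \<noteq> 0"
  using p2 by auto

lemma M_pos: "i \<in> {1..p} \<Longrightarrow> 0 < M i"
  using mM by force

lemma At_carrier: "At \<in> carrier_mat (n p) d"
  by (rule At_dim) simp

lemma At_mult_carrier [simp]: "At *\<^sub>v v \<in> carrier_vec (n p)"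
  using At_carrier by (intro carrier_vecI) simp

lemma dim_At [simp]: "dim_row (A p) = d" "dim_col (A p) = n p"
  using At_carrier by auto

lemma gp_carrier [simp]: "gp (xs k p) \<in> carrier_vec (n p)"
  using A2_grad[of "xs k p"] by (simp add: has_grad_def)

lemma dim_gp [simp]: "dim_vec (gp (xs k p)) = n p"
  by (rule carrier_vecD) simp

lemma err_carrier [simp]: "err k \<in> carrier_vec (n p)"
  using carrier_vecD[OF gw_xs_carrier[of k p "k - 1"]]
  by (cases "k = 0") (auto simp: err_def intro!: carrier_vecI)

lemma dim_err [simp]: "dim_vec (err k) = n p"
  by (rule carrier_vecD) simp

lemma U_carrier [simp]: "U k \<in> carrier_vec (n p)"
  by (simp add: U_def)

lemma dim_U [simp]: "dim_vec (U k) = n p"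
  by (rule carrier_vecD) simp

lemma sq_nonneg [simp]: "0 \<le> sq k i"
  by (simp add: sq_def)

lemma sq_pos_index: "k \<ge> 1 \<Longrightarrow> sq k i = (vnorm (dx k i))\<^sup>2"
  by (simp add: sq_def)

lemma sq_less_p: "i < p \<Longrightarrow> sq k i = (vnorm (dx k i))\<^sup>2"
  by (simp add: sq_def)

lemma dx_0: "i \<in> {1..p} \<Longrightarrow> dx 0 i = 0\<^sub>v (n i)"
  using xs_carrier[of i 0] by simp

lemma vnorm_err_le: "(vnorm (err k))\<^sup>2 \<le> (M p)\<^sup>2 * sq k p"
proof (cases k)
  case 0
  then show ?thesis using M_pos[of p] by (simp add: sq_def)
next
  case (Suc l)
  then have "vnorm (err k) \<le> M p * vnorm (dx k p)"
    using w_class[of k p] xs_edom[of p] by (auto simp: dgf_class_def err_def)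
  then have "(vnorm (err k))\<^sup>2 \<le> (M p * vnorm (dx k p))\<^sup>2" by (intro power_mono) auto
  then show ?thesis using Suc by (simp add: sq_pos_index power_mult_distrib)
qed

lemma U_eq: "U k = gp (xs k p) - \<beta> \<cdot>\<^sub>v vsum (n p) (\<lambda>j. At *\<^sub>v adx k j) {1..<p} + err k"
proof (cases "k = 0")
  case True
  have "vsum (n p) (\<lambda>j. At *\<^sub>v adx 0 j) {1..<p} = vsum (n p) (\<lambda>j. 0\<^sub>v (n p)) {1..<p}"
  proof (rule eq_vecI)
    fix r assume r: "r < dim_vec (vsum (n p) (\<lambda>j. 0\<^sub>v (n p) :: real vec) {1..<p})"
    have "(At *\<^sub>v adx 0 j) $ r = 0" if "j \<in> {1..<p}" for j
    proof -
      have j: "j \<in> {1..p}" using that by simp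
      have "adx 0 j = 0\<^sub>v d" unfolding dx_0[OF j] using A_dim[OF j] by (intro eq_vecI) auto
      then show ?thesis using r At_carrier by simp
    qed
    then show "vsum (n p) (\<lambda>j. At *\<^sub>v adx 0 j) {1..<p} $ r = vsum (n p) (\<lambda>j. 0\<^sub>v (n p)) {1..<p} $ r"
      using r by simp
  qed simp
  then show ?thesis
    using True unfolding U_def err_def by (intro eq_vecI) auto
next
  case False
  have s: "{1..p} - {p} = {1..<p}" by auto
  have "At *\<^sub>v lamh k = gp (xs k p) + Rv k p"
    using False by (intro eq_vecI) (auto simp flip: gp_eq)
  then show ?thesis
    using False carrier_vecD[OF gw_xs_carrier[of k p "k - 1"]] unfolding U_def err_def Rv_def s
    by (intro eq_vecI) (auto simp: algebra_simps)
qed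

lemma opnorm_A_le_amax: "i \<in> {1..<p} \<Longrightarrow> (opnorm (A i))\<^sup>2 \<le> amax"
  by (intro Max_ge) auto

lemma amax_nonneg: "0 \<le> amax"
  using order_trans[OF zero_le_power2 opnorm_A_le_amax[of 1]] p2 by simp

lemma vnorm_adx_le:
  assumes "i \<in> {1..p}"
  shows "(vnorm (adx k i))\<^sup>2 \<le> (opnorm (A i))\<^sup>2 * (vnorm (dx k i))\<^sup>2"
proof -
  have "vnorm (adx k i) \<le> opnorm (A i) * vnorm (dx k i)"
    using assms by (intro vnorm_mult_mat_vec_le[OF A_dim]) auto
  then show ?thesis by (metis power_mono power_mult_distrib vnorm_nonneg)
qed

lemma vnorm_adx_le_amax: "i \<in> {1..<p} \<Longrightarrow> (vnorm (adx k i))\<^sup>2 \<le> amax * sq k i"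
  using vnorm_adx_le[of i k] mult_right_mono[OF opnorm_A_le_amax, of i "(vnorm (dx k i))\<^sup>2"]
  by (simp add: sq_less_p)

text \<open>By \<open>U_eq\<close> the difference is a sum of p + 1 vectors: the change of gradient,
  the change of \<open>err\<close> and p - 1 cross terms. Cauchy-Schwarz gives the factor p + 1; the
  factors 2 come from splitting differences of consecutive increments.\<close>

lemma diff_U_le:
  assumes k: "k \<ge> 1"
  shows "(vnorm (U k - U (k - 1)))\<^sup>2 \<le> (real p + 1) * (Lp\<^sup>2 * sq k p
    + 2 * (M p)\<^sup>2 * (sq k p + sq (k - 1) p)
    + 2 * \<beta>\<^sup>2 * (opnorm At)\<^sup>2 * amax * (\<Sum>i\<in>{1..<p}. sq k i + sq (k - 1) i))"
proof -
  \<comment> \<open>Index 0 is free, as blocks are numbered from 1, and holds the gradient term;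
    index p holds the \<open>err\<close> term.\<close>
  define g where "g j = (if j = 0 then gp (xs k p) - gp (xs (k - 1) p)
    else if j = p then err k - err (k - 1)
    else (- \<beta>) \<cdot>\<^sub>v (At *\<^sub>v (adx k j - adx (k - 1) j)))" for j
  have gc: "g j \<in> carrier_vec (n p)" for j
    by (simp add: g_def)
  have split: "{0..p} = insert 0 (insert p {1..<p})" by auto
  have At1: "(At *\<^sub>v (adx k j - adx (k - 1) j)) $ r = (At *\<^sub>v adx k j) $ r - (At *\<^sub>v adx (k - 1) j) $ r"
    if "j \<in> {1..<p}" "r < n p" for j r
    using that mult_minus_distrib_mat_vec[OF At_carrier, of "adx k j" "adx (k - 1) j"] At_carrier by simp
  have "U k - U (k - 1) = vsum (n p) g {0..p}"
  proof (rule eq_vecI)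
    fix r assume "r < dim_vec (vsum (n p) g {0..p})"
    then have r: "r < n p" by simp
    have "(\<Sum>j\<in>{1..<p}. g j $ r) = - \<beta> * (\<Sum>j\<in>{1..<p}. (At *\<^sub>v adx k j) $ r - (At *\<^sub>v adx (k - 1) j) $ r)"
      using r At1 At_carrier by (simp add: g_def sum_distrib_left)
    then show "(U k - U (k - 1)) $ r = vsum (n p) g {0..p} $ r"
      using r unfolding split U_eq[of k] U_eq[of "k - 1"]
      by (simp add: sum_subtractf) (simp add: g_def algebra_simps)
  qed simp
  then have "(vnorm (U k - U (k - 1)))\<^sup>2 \<le> real (card {0..p}) * (\<Sum>j\<in>{0..p}. (vnorm (g j))\<^sup>2)"
    using vnorm_vsum_power2_le[of "{0..p}" g "n p"] gc by simp
  also have "(\<Sum>j\<in>{0..p}. (vnorm (g j))\<^sup>2)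
    = (vnorm (g 0))\<^sup>2 + (vnorm (g p))\<^sup>2 + (\<Sum>j\<in>{1..<p}. (vnorm (g j))\<^sup>2)"
    unfolding split by simp
  finally have 1: "(vnorm (U k - U (k - 1)))\<^sup>2
    \<le> (real p + 1) * ((vnorm (g 0))\<^sup>2 + (vnorm (g p))\<^sup>2 + (\<Sum>j\<in>{1..<p}. (vnorm (g j))\<^sup>2))"
    by (simp add: add.commute)
  have "vnorm (g 0) \<le> Lp * vnorm (dx k p)"
    using A2_lip[of "xs k p" "xs (k - 1) p"] by (simp add: g_def)
  then have "(vnorm (g 0))\<^sup>2 \<le> (Lp * vnorm (dx k p))\<^sup>2" by (intro power_mono) auto
  then have g0: "(vnorm (g 0))\<^sup>2 \<le> Lp\<^sup>2 * sq k p"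
    using k by (simp add: sq_pos_index power_mult_distrib)
  have "(vnorm (g p))\<^sup>2 \<le> 2 * (vnorm (err k))\<^sup>2 + 2 * (vnorm (err (k - 1)))\<^sup>2"
    using vnorm_minus_power2_le[of "err k" "n p" "err (k - 1)"] by (simp add: g_def)
  then have gpp: "(vnorm (g p))\<^sup>2 \<le> 2 * (M p)\<^sup>2 * (sq k p + sq (k - 1) p)"
    using vnorm_err_le[of k] vnorm_err_le[of "k - 1"] by (simp add: algebra_simps)
  have "(vnorm (g j))\<^sup>2 \<le> 2 * \<beta>\<^sup>2 * (opnorm At)\<^sup>2 * amax * (sq k j + sq (k - 1) j)" if j: "j \<in> {1..<p}" for j
  proof -
    have "(vnorm (g j))\<^sup>2 = \<beta>\<^sup>2 * (vnorm (At *\<^sub>v (adx k j - adx (k - 1) j)))\<^sup>2"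
      using j by (simp add: g_def power_mult_distrib)
    also have "\<dots> \<le> \<beta>\<^sup>2 * (opnorm At * vnorm (adx k j - adx (k - 1) j))\<^sup>2"
      using j by (intro mult_left_mono power_mono vnorm_mult_mat_vec_le[OF At_carrier]) auto
    also have "\<dots> \<le> \<beta>\<^sup>2 * ((opnorm At)\<^sup>2 * (2 * (vnorm (adx k j))\<^sup>2 + 2 * (vnorm (adx (k - 1) j))\<^sup>2))"
      unfolding power_mult_distrib using j
      by (intro mult_left_mono vnorm_minus_power2_le[of _ d]) auto
    also have "\<dots> \<le> \<beta>\<^sup>2 * ((opnorm At)\<^sup>2 * (2 * (amax * sq k j) + 2 * (amax * sq (k - 1) j)))"
      using vnorm_adx_le_amax[OF j, of k] vnorm_adx_le_amax[OF j, of "k - 1"]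
      by (intro mult_left_mono add_mono) auto
    finally show ?thesis by (simp add: algebra_simps)
  qed
  then have "(\<Sum>j\<in>{1..<p}. (vnorm (g j))\<^sup>2)
      \<le> (\<Sum>j\<in>{1..<p}. 2 * \<beta>\<^sup>2 * (opnorm At)\<^sup>2 * amax * (sq k j + sq (k - 1) j))"
    by (rule sum_mono)
  then have "(\<Sum>j\<in>{1..<p}. (vnorm (g j))\<^sup>2)
      \<le> 2 * \<beta>\<^sup>2 * (opnorm At)\<^sup>2 * amax * (\<Sum>j\<in>{1..<p}. sq k j + sq (k - 1) j)"
    by (simp only: sum_distrib_left)
  then have "(vnorm (g 0))\<^sup>2 + (vnorm (g p))\<^sup>2 + (\<Sum>j\<in>{1..<p}. (vnorm (g j))\<^sup>2)
    \<le> Lp\<^sup>2 * sq k p + 2 * (M p)\<^sup>2 * (sq k p + sq (k - 1) p)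
    + 2 * \<beta>\<^sup>2 * (opnorm At)\<^sup>2 * amax * (\<Sum>i\<in>{1..<p}. sq k i + sq (k - 1) i)"
    using g0 gpp by linarith
  then show ?thesis
    by (intro order_trans[OF 1] mult_left_mono) auto
qed

lemma At_dlm_step:
  assumes k: "k \<ge> 1"
  shows "At *\<^sub>v dlm k = (1 - \<theta>) \<cdot>\<^sub>v (At *\<^sub>v dlm (k - 1)) + \<theta> \<cdot>\<^sub>v (U k - U (k - 1))"
proof -
  define lh where "lh k = (if k = 0 then lam 0 else lamh k)" for k
  have lhc [simp]: "lh k \<in> carrier_vec d" for k by (simp add: lh_def)
  have lhd [simp]: "dim_vec (lh k) = d" for k by (rule carrier_vecD) simp
  have U: "U k = At *\<^sub>v lh k" for k by (simp add: U_def lh_def)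
  \<comment> \<open>At l = 0 both terms reduce to \<open>lam 0\<close>, since
    \<open>lam (0 - 1)\<close> is \<open>lam 0\<close>. Hence the increment recursion already holds
    for k = 1, with a zero previous increment.\<close>
  have lam_eq: "lam l = (1 - \<theta>) \<cdot>\<^sub>v lam (l - 1) + \<theta> \<cdot>\<^sub>v lh l" for l
  proof (cases "l = 0")
    case True
    then show ?thesis
      by (intro eq_vecI) (auto simp: lh_def algebra_simps)
  next
    case False
    then have "lam l = lam (l - 1) - (\<theta> * \<beta>) \<cdot>\<^sub>v res l" using lam_step[of l] by simp
    moreover have "lh l = lam (l - 1) - \<beta> \<cdot>\<^sub>v res l" using False by (simp add: lh_def lamh_def)
    ultimately show ?thesis
      by (intro eq_vecI) (auto simp: algebra_simps)
  qed
  have "dlm k = (1 - \<theta>) \<cdot>\<^sub>v dlm (k - 1) + \<theta> \<cdot>\<^sub>v (lh k - lh (k - 1))"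
  proof (rule eq_vecI)
    fix r assume "r < dim_vec ((1 - \<theta>) \<cdot>\<^sub>v dlm (k - 1) + \<theta> \<cdot>\<^sub>v (lh k - lh (k - 1)))"
    then have r: "r < d" by simp
    have e: "lam l $ r = (1 - \<theta>) * lam (l - 1) $ r + \<theta> * lh l $ r" for l
      using arg_cong[OF lam_eq[of l], of "\<lambda>v. v $ r"] r by simp
    show "dlm k $ r = ((1 - \<theta>) \<cdot>\<^sub>v dlm (k - 1) + \<theta> \<cdot>\<^sub>v (lh k - lh (k - 1))) $ r"
      using r e[of k] e[of "k - 1"]
      by (simp add: algebra_simps)
  qed simp
  then show ?thesis
    unfolding U by (simp add: mult_add_distrib_mat_vec[OF At_carrier] mult_mat_vec[OF At_carrier]
        mult_minus_distrib_mat_vec[OF At_carrier])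
qed

lemma \<gamma>_pos: "0 < \<gamma>"
  using theta unfolding gamma_theta_def by (intro divide_pos_pos) (auto simp: abs_if)

lemma \<sigma>_pos: "0 < \<sigma>"
  using sigma_plus_props(1)[OF A_dim A1_nz] by simp

lemma At_dlm_le:
  assumes k: "k \<ge> 1"
  defines "t \<equiv> \<bar>\<theta> - 1\<bar>"
  shows "(vnorm (At *\<^sub>v dlm k))\<^sup>2
    \<le> t / (1 - t) * ((vnorm (At *\<^sub>v dlm (k - 1)))\<^sup>2 - (vnorm (At *\<^sub>v dlm k))\<^sup>2)
      + \<theta> * \<gamma> * (vnorm (U k - U (k - 1)))\<^sup>2"
proof -
  have t: "0 \<le> t" "t < 1" using theta by (auto simp: t_def)
  let ?a = "(vnorm (At *\<^sub>v dlm k))\<^sup>2" and ?a' = "(vnorm (At *\<^sub>v dlm (k - 1)))\<^sup>2"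
    and ?u = "(vnorm (U k - U (k - 1)))\<^sup>2"
  have "?a \<le> t * ?a' + \<theta>\<^sup>2 / (1 - t) * ?u"
    unfolding At_dlm_step[OF k] t_def
    by (rule convex_combination_power2_le[of _ "n p"]) (use theta in \<open>auto intro!: carrier_vecI\<close>)
  then have "(1 - t) * ?a \<le> t * (?a' - ?a) + \<theta>\<^sup>2 / (1 - t) * ?u" by (simp add: algebra_simps)
  then have "(1 - t) * ?a / (1 - t) \<le> (t * (?a' - ?a) + \<theta>\<^sup>2 / (1 - t) * ?u) / (1 - t)"
    using t by (intro divide_right_mono) auto
  also have "\<dots> = t / (1 - t) * (?a' - ?a) + \<theta>\<^sup>2 / (1 - t) * ?u / (1 - t)"
    by (simp add: add_divide_distrib)
  also have "\<theta>\<^sup>2 / (1 - t) * ?u / (1 - t) = \<theta> * \<gamma> * ?u"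
    using t by (simp add: gamma_theta_def t_def power2_eq_square)
  finally show ?thesis using t by simp
qed

text \<open>The range condition (A1) at work: it admits the multiplier increments, multiples of
  residuals, to the eigenvalue bound of \<open>sigma_plus_props\<close>, which concerns Im
  A_p.\<close>

lemma res_in_image: "\<exists>y\<in>carrier_vec (n p). A p *\<^sub>v y = res k"
proof -
  have Ap: "A p \<in> carrier_mat d (n p)" by (rule A_dim) simp
  have "\<exists>y\<in>carrier_vec (n p). A p *\<^sub>v y = A i *\<^sub>v xs k i" if "i \<in> {1..p}" for i
    using that A1_im[of i "xs k i"] xs_carrier[OF that] by (cases "i = p") auto
  then obtain y where y: "\<And>i. i \<in> {1..p} \<Longrightarrow> y i \<in> carrier_vec (n p) \<and> A p *\<^sub>v y i = A i *\<^sub>v xs k i"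
    by metis
  obtain yb where yb: "yb \<in> carrier_vec (n p)" "A p *\<^sub>v yb = b" using A1_b by blast
  have "A p *\<^sub>v (vsum (n p) y {1..p} - yb) = vsum d (\<lambda>i. A p *\<^sub>v y i) {1..p} - b"
    using yb y mult_mat_vsum[OF Ap, of "{1..p}" y] by (simp add: mult_minus_distrib_mat_vec[OF Ap])
  also have "\<dots> = res k"
    using y b_dim by (intro eq_vecI) (auto simp: resid_def)
  finally show ?thesis using yb by (intro bexI[of _ "vsum (n p) y {1..p} - yb"]) auto
qed

lemma dlm_eq: "k \<ge> 1 \<Longrightarrow> dlm k = (- (\<theta> * \<beta>)) \<cdot>\<^sub>v res k"
  using lam_step[of k] by (intro eq_vecI) auto

lemma vnorm_dlm: "k \<ge> 1 \<Longrightarrow> vnorm (dlm k) = \<theta> * \<beta> * vnorm (res k)"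
  using theta \<beta>_pos by (subst dlm_eq) (auto simp: abs_mult)

lemma vnorm_dlm_le:
  assumes k: "k \<ge> 1"
  shows "\<sigma> * (vnorm (dlm k))\<^sup>2 \<le> (vnorm (At *\<^sub>v dlm k))\<^sup>2"
proof -
  have Ap: "A p \<in> carrier_mat d (n p)" by (rule A_dim) simp
  obtain y where y: "y \<in> carrier_vec (n p)" "A p *\<^sub>v y = res k" using res_in_image by blast
  have "A p *\<^sub>v ((- (\<theta> * \<beta>)) \<cdot>\<^sub>v y) = dlm k"
    unfolding dlm_eq[OF k] y(2)[symmetric] using y by (intro mult_mat_vec[OF Ap])
  then show ?thesis
    using sigma_plus_props(2)[OF Ap A1_nz, of "(- (\<theta> * \<beta>)) \<cdot>\<^sub>v y"] y by simp
qed

end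

section \<open>The potential function\<close>

text \<open>If \<Phi> k < v, monotonicity keeps every later L below \<Phi> k, so q falls by at least
  v - \<Phi> k in each step and eventually becomes negative. With \<Phi> \<ge> v established, the
  sum of the D telescopes.\<close>

lemma descent_bounds:
  fixes \<Phi> L D q :: "nat \<Rightarrow> real"
  assumes desc: "\<And>k. k \<ge> 1 \<Longrightarrow> \<Phi> k \<le> \<Phi> (k - 1) - D k" and D: "\<And>k. k \<ge> 1 \<Longrightarrow> 0 \<le> D k"
    and L\<Phi>: "\<And>k. L k \<le> \<Phi> k" and q: "\<And>k. 0 \<le> q k"
    and Lq: "\<And>k. k \<ge> 1 \<Longrightarrow> v + q k - q (k - 1) \<le> L k"
  shows "v \<le> \<Phi> k" and "(\<Sum>j\<in>{1..k}. D j) \<le> \<Phi> 0 - v"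
proof -
  have dec: "\<Phi> (i + j) \<le> \<Phi> i" for i j
  proof (induction j)
    case (Suc j)
    then show ?case using desc[of "i + Suc j"] D[of "i + Suc j"] by simp
  qed simp
  have v: "v \<le> \<Phi> k" for k
  proof (rule ccontr)
    assume "\<not> v \<le> \<Phi> k"
    then have e: "v - \<Phi> k > 0" by simp
    have bound: "q (k + j) \<le> q k - real j * (v - \<Phi> k)" for j
    proof (induction j)
      case (Suc j)
      have "v + q (k + Suc j) - q (k + j) \<le> \<Phi> k"
        using Lq[of "k + Suc j"] L\<Phi>[of "k + Suc j"] dec[of k "Suc j"] by simp
      then show ?case using Suc by (simp add: algebra_simps)
    qed simp
    obtain j where "q k < real j * (v - \<Phi> k)"
      using e reals_Archimedean3 by blast
    then show False using bound[of j] q[of "k + j"] by linarith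
  qed
  then show "v \<le> \<Phi> k" .
  have "(\<Sum>j\<in>{1..k}. D j) \<le> \<Phi> 0 - \<Phi> k" for k
  proof (induction k)
    case (Suc k)
    then show ?case using desc[of "Suc k"] by simp
  qed simp
  then show "(\<Sum>j\<in>{1..k}. D j) \<le> \<Phi> 0 - v" using v[of k] by (meson diff_left_mono order_trans)
qed

section \<open>The augmented Lagrangian along the iterates\<close>

context nepj_admm
begin

definition L :: "nat \<Rightarrow> real" where
  "L k = (\<Sum>i\<in>{1..p}. F i (xs k i)) - lam k \<bullet> res k + \<beta> / 2 * (vnorm (res k))\<^sup>2"

abbreviation "v \<equiv> real_of_ereal (val_fun p n d f A b \<beta>)"

definition \<Phi> :: "nat \<Rightarrow> real" where
  "\<Phi> k = L k + \<bar>\<theta> - 1\<bar> / ((1 - \<bar>\<theta> - 1\<bar>) * (\<beta> * \<theta> * \<sigma>)) * (vnorm (At *\<^sub>v dlm k))\<^sup>2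
     + (\<Sum>i\<in>{1..p}. m i / 4 * sq k i)"

lemma val_fun_le:
  assumes "\<And>i. i \<in> {1..p} \<Longrightarrow> x i \<in> carrier_vec (n i)" "\<And>i. i \<in> {1..p} \<Longrightarrow> \<bar>f i (x i)\<bar> \<noteq> \<infinity>"
  shows "val_fun p n d f A b \<beta>
    \<le> ereal ((\<Sum>i\<in>{1..p}. F i (x i)) + \<beta> / 2 * (vnorm (resid p d A b x))\<^sup>2)"
proof -
  have "(\<Sum>i\<in>{1..p}. f i (x i)) = (\<Sum>i\<in>{1..p}. ereal (F i (x i)))"
    using assms(2) by (intro sum.cong refl) (auto simp: ereal_real)
  then have "(\<Sum>i\<in>{1..p}. f i (x i)) = ereal (\<Sum>i\<in>{1..p}. F i (x i))"
    by simp
  moreover have "val_fun p n d f A b \<beta>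
    \<le> (\<Sum>i\<in>{1..p}. f i (x i)) + ereal (\<beta> / 2 * (vnorm (resid p d A b x))\<^sup>2)"
    unfolding val_fun_def using assms(1) by (intro INF_lower) auto
  ultimately show ?thesis by simp
qed

lemma val_fun_ereal: "val_fun p n d f A b \<beta> = ereal v"
proof -
  have "val_fun p n d f A b \<beta> < \<infinity>"
    using val_fun_le[of "xs 0"] f_xs_finite[of _ 0] by (auto intro: le_less_trans)
  then show ?thesis using A3 by (cases "val_fun p n d f A b \<beta>") auto
qed

lemma v_le: "v \<le> (\<Sum>i\<in>{1..p}. F i (xs k i)) + \<beta> / 2 * (vnorm (res k))\<^sup>2"
  by (metis ereal_less_eq(3) val_fun_ereal val_fun_le f_xs_finite xs_carrier)

text \<open>Expanding |lambda^k + \<theta> \<beta> res^k|^2 = |lambda^(k-1)|^2 and dropping the last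
  square bounds the inner product of lambda^k with the residual by a telescoping quantity.\<close>

lemma L_lower:
  assumes k: "k \<ge> 1"
  shows "v + (vnorm (lam k))\<^sup>2 / (2 * \<beta> * \<theta>) - (vnorm (lam (k - 1)))\<^sup>2 / (2 * \<beta> * \<theta>) \<le> L k"
proof -
  have "lam (k - 1) = lam k + (\<theta> * \<beta>) \<cdot>\<^sub>v res k"
    using lam_step[OF k] by (intro eq_vecI) auto
  then have "(vnorm (lam (k - 1)))\<^sup>2
      = (vnorm (lam k))\<^sup>2 + 2 * (\<theta> * \<beta>) * (lam k \<bullet> res k) + (vnorm ((\<theta> * \<beta>) \<cdot>\<^sub>v res k))\<^sup>2"
    using vnorm_add_power2[of "lam k" d "(\<theta> * \<beta>) \<cdot>\<^sub>v res k"] by simp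
  then have "2 * (\<theta> * \<beta>) * (lam k \<bullet> res k) \<le> (vnorm (lam (k - 1)))\<^sup>2 - (vnorm (lam k))\<^sup>2"
    using zero_le_power2[of "vnorm ((\<theta> * \<beta>) \<cdot>\<^sub>v res k)"] by linarith
  then have "lam k \<bullet> res k \<le> ((vnorm (lam (k - 1)))\<^sup>2 - (vnorm (lam k))\<^sup>2) / (2 * \<beta> * \<theta>)"
    using theta \<beta>_pos by (simp add: field_simps)
  then show ?thesis using v_le[of k] by (simp add: L_def diff_divide_distrib)
qed

lemma L_step:
  assumes k: "k \<ge> 1"
  shows "L k = (\<Sum>i\<in>{1..p}. F i (xs k i)) - lam (k - 1) \<bullet> res k + \<beta> / 2 * (vnorm (res k))\<^sup>2
    + (vnorm (dlm k))\<^sup>2 / (\<beta> * \<theta>)"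
proof -
  have "lam k = lam (k - 1) - (\<theta> * \<beta>) \<cdot>\<^sub>v res k" by (rule lam_step[OF k])
  then have "lam k \<bullet> res k = lam (k - 1) \<bullet> res k - \<theta> * \<beta> * (vnorm (res k))\<^sup>2"
    using minus_scalar_prod_distrib[of "lam (k - 1)" d "(\<theta> * \<beta>) \<cdot>\<^sub>v res k" "res k"]
      smult_scalar_prod_distrib[of "res k" d "res k" "\<theta> * \<beta>"] by (simp add: vnorm_power2)
  moreover have "(vnorm (dlm k))\<^sup>2 / (\<beta> * \<theta>) = \<theta> * \<beta> * (vnorm (res k))\<^sup>2"
    unfolding vnorm_dlm[OF k] using theta \<beta>_pos by (simp add: power2_eq_square)
  ultimately show ?thesis by (simp add: L_def)
qed

text \<open>Rewritten so that \<gamma> (p + 1) / (\<beta> \<sigma>), the weight of the multiplier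
  error in the descent estimate, appears as a common factor.\<close>

lemma delta_less_p:
  "i < p \<Longrightarrow> \<delta> i = m i / 4 - ((real p - 2 + \<alpha>) / 2 * \<beta> * amax
    + 2 * (\<gamma> * (real p + 1) / (\<beta> * \<sigma>)) * \<beta>\<^sup>2 * (opnorm At)\<^sup>2 * amax)"
proof -
  assume i: "i < p"
  have e: "2 * (\<gamma> * (real p + 1) / (\<beta> * \<sigma>)) * \<beta>\<^sup>2 = 2 * \<gamma> * (real p + 1) / \<sigma> * \<beta>"
    using \<beta>_pos by (simp add: power2_eq_square)
  have expand: "x - (c + y * z) * \<beta> * a = x - (c * \<beta> * a + y * \<beta> * z * a)" for x c y z a :: real
    by (simp add: algebra_simps)
  show ?thesis
    unfolding delta_par_def e expand[symmetric] using i by (simp only: if_True)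
qed

lemma delta_p:
  "\<delta> p = m p / 4 - (\<beta> / 2 * ((real p - 1) / \<alpha>) * (opnorm (A p))\<^sup>2
    + \<gamma> * (real p + 1) / (\<beta> * \<sigma>) * (Lp\<^sup>2 + 2 * (M p)\<^sup>2))"
  using \<beta>_pos \<sigma>_pos \<alpha>_pos unfolding delta_par_def by simp

text \<open>Strong convexity gives 2 X k: one copy is stored in \<Phi> k, the other remains, and the
  X (k - 1) stored in \<Phi> (k - 1) is released. Against these stand the coupling costs
  \<open>E\<close> and \<open>J\<close> and the multiplier costs \<open>G\<close> and
  \<open>H\<close>.\<close>

lemma potential_descent:
  assumes k: "k \<ge> 1"
  shows "\<Phi> k \<le> \<Phi> (k - 1) - (\<Sum>i\<in>{1..p}. \<delta> i * (sq k i + sq (k - 1) i))"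
proof -
  define t where "t = \<bar>\<theta> - 1\<bar>"
  define G where "G = \<gamma> * (real p + 1) / (\<beta> * \<sigma>)"
  define H where "H = 2 * G * \<beta>\<^sup>2 * (opnorm At)\<^sup>2 * amax"
  define S where "S k = (\<Sum>i\<in>{1..<p}. sq k i)" for k
  define ca where "ca = t / ((1 - t) * (\<beta> * \<theta> * \<sigma>))"
  let ?a = "\<lambda>k. (vnorm (At *\<^sub>v dlm k))\<^sup>2"
  have G0: "0 \<le> G" using \<gamma>_pos \<beta>_pos \<sigma>_pos by (simp add: G_def)
  have S0: "0 \<le> S k" for k by (simp add: S_def sum_nonneg)
  have bts: "0 < \<beta> * \<theta> * \<sigma>" using \<beta>_pos \<sigma>_pos theta by simp
  have "(vnorm (dlm k))\<^sup>2 / (\<beta> * \<theta>) \<le> ?a k / (\<beta> * \<theta> * \<sigma>)"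
    using vnorm_dlm_le[OF k] \<beta>_pos \<sigma>_pos theta by (simp add: field_simps)
  also have "\<dots> \<le> (t / (1 - t) * (?a (k - 1) - ?a k) + \<theta> * \<gamma> * (vnorm (U k - U (k - 1)))\<^sup>2) / (\<beta> * \<theta> * \<sigma>)"
    using At_dlm_le[OF k] bts unfolding t_def by (intro divide_right_mono) auto
  also have "\<dots> = ca * (?a (k - 1) - ?a k) + \<gamma> / (\<beta> * \<sigma>) * (vnorm (U k - U (k - 1)))\<^sup>2"
    using theta by (simp add: ca_def add_divide_distrib)
  also have "\<gamma> / (\<beta> * \<sigma>) * (vnorm (U k - U (k - 1)))\<^sup>2
    \<le> \<gamma> / (\<beta> * \<sigma>) * ((real p + 1) * (Lp\<^sup>2 * sq k p
    + 2 * (M p)\<^sup>2 * (sq k p + sq (k - 1) p)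
    + 2 * \<beta>\<^sup>2 * (opnorm At)\<^sup>2 * amax * (\<Sum>i\<in>{1..<p}. sq k i + sq (k - 1) i)))"
    using \<gamma>_pos \<beta>_pos \<sigma>_pos by (intro mult_left_mono diff_U_le[OF k]) auto
  also have "\<dots> = G * (Lp\<^sup>2 * sq k p + 2 * (M p)\<^sup>2 * (sq k p + sq (k - 1) p)) + H * (S k + S (k - 1))"
    by (simp add: G_def H_def S_def sum.distrib algebra_simps add_divide_distrib)
  finally have 1: "(vnorm (dlm k))\<^sup>2 / (\<beta> * \<theta>) \<le> ca * (?a (k - 1) - ?a k)
    + (G * (Lp\<^sup>2 * sq k p + 2 * (M p)\<^sup>2 * (sq k p + sq (k - 1) p)) + H * (S k + S (k - 1)))"
    by simp
  have ins: "{1..p} = insert p {1..<p}" by auto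
  have "(\<Sum>i\<in>{1..<p}. (vnorm (adx k i))\<^sup>2) \<le> (\<Sum>i\<in>{1..<p}. amax * sq k i)"
    by (intro sum_mono vnorm_adx_le_amax)
  then have aS: "(\<Sum>i\<in>{1..<p}. (vnorm (adx k i))\<^sup>2) \<le> amax * S k"
    by (simp add: S_def sum_distrib_left)
  have ap: "(vnorm (adx k p))\<^sup>2 \<le> (opnorm (A p))\<^sup>2 * sq k p"
    using vnorm_adx_le[of p k] k by (simp add: sq_pos_index)
  have "(real p - 2 + \<alpha>) * (\<Sum>i\<in>{1..<p}. (vnorm (adx k i))\<^sup>2) + (real p - 1) / \<alpha> * (vnorm (adx k p))\<^sup>2
    \<le> (real p - 2 + \<alpha>) * (amax * S k) + (real p - 1) / \<alpha> * ((opnorm (A p))\<^sup>2 * sq k p)"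
    using p2 \<alpha>_pos by (intro add_mono mult_left_mono aS ap) auto
  then have 2: "\<beta> / 2 * ((real p - 2 + \<alpha>) * (\<Sum>i\<in>{1..<p}. (vnorm (adx k i))\<^sup>2) + (real p - 1) / \<alpha> * (vnorm (adx k p))\<^sup>2)
    \<le> \<beta> / 2 * ((real p - 2 + \<alpha>) * (amax * S k) + (real p - 1) / \<alpha> * ((opnorm (A p))\<^sup>2 * sq k p))"
    using \<beta>_pos by (intro mult_left_mono) auto
  define E where "E = (real p - 2 + \<alpha>) / 2 * \<beta> * amax"
  define J where "J = \<beta> / 2 * ((real p - 1) / \<alpha>) * (opnorm (A p))\<^sup>2"
  have E0: "0 \<le> E" using p2 \<alpha>_pos \<beta>_pos amax_nonneg by (simp add: E_def)
  have J0: "0 \<le> J" using p2 \<alpha>_pos \<beta>_pos by (simp add: J_def)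
  have 3: "\<beta> / 2 * ((real p - 2 + \<alpha>) * (amax * S k) + (real p - 1) / \<alpha> * ((opnorm (A p))\<^sup>2 * sq k p))
    = E * S k + J * sq k p"
  proof -
    have "\<beta> / 2 * (c * (a * s) + P * (q * r)) = c / 2 * \<beta> * a * s + \<beta> / 2 * P * q * r"
      for c a s P q r :: real
      by (simp add: algebra_simps)
    then show ?thesis unfolding E_def J_def .
  qed
  define m4 where "m4 i = m i / 4" for i
  define X where "X k = (\<Sum>i\<in>{1..p}. m4 i * sq k i)" for k
  have m2: "(\<Sum>i\<in>{1..p}. m i / 2 * (vnorm (dx k i))\<^sup>2) = 2 * X k"
    unfolding X_def m4_def using k by (simp add: sq_pos_index sum_distrib_left)
  have 4: "L k \<le> L (k - 1) - 2 * X k + (E * S k + J * sq k p)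
    + (ca * (?a (k - 1) - ?a k)
      + (G * (Lp\<^sup>2 * sq k p + 2 * (M p)\<^sup>2 * (sq k p + sq (k - 1) p)) + H * (S k + S (k - 1))))"
    using primal_descent[OF k] 1 2 L_step[OF k] unfolding 3 m2 L_def[of "k - 1"] by linarith
  have d: "(\<Sum>i\<in>{1..p}. \<delta> i * (sq k i + sq (k - 1) i))
    = X k + X (k - 1)
      - (E + H) * (S k + S (k - 1))
      - (J + G * (Lp\<^sup>2 + 2 * (M p)\<^sup>2)) * (sq k p + sq (k - 1) p)"
  proof -
    have "(\<Sum>i\<in>{1..<p}. \<delta> i * (sq k i + sq (k - 1) i))
      = (\<Sum>i\<in>{1..<p}. (m4 i - (E + H)) * (sq k i + sq (k - 1) i))"
      by (intro sum.cong refl) (simp add: delta_less_p E_def H_def G_def m4_def)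
    also have "\<dots> = (\<Sum>i\<in>{1..<p}. m4 i * sq k i) + (\<Sum>i\<in>{1..<p}. m4 i * sq (k - 1) i)
        - (E + H) * (S k + S (k - 1))"
      by (simp add: S_def sum.distrib sum_subtractf sum_distrib_left algebra_simps)
    finally have less_p: "(\<Sum>i\<in>{1..<p}. \<delta> i * (sq k i + sq (k - 1) i))
      = (\<Sum>i\<in>{1..<p}. m4 i * sq k i) + (\<Sum>i\<in>{1..<p}. m4 i * sq (k - 1) i)
        - (E + H) * (S k + S (k - 1))" .
    have at_p: "\<delta> p = m4 p - (J + G * (Lp\<^sup>2 + 2 * (M p)\<^sup>2))"
      unfolding delta_p J_def G_def m4_def by simp
    have "(\<Sum>i\<in>{1..p}. \<delta> i * (sq k i + sq (k - 1) i))
      = (\<Sum>i\<in>{1..<p}. \<delta> i * (sq k i + sq (k - 1) i)) + \<delta> p * (sq k p + sq (k - 1) p)"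
      unfolding ins by simp
    then show ?thesis unfolding less_p at_p unfolding ins X_def by (simp add: algebra_simps)
  qed
  \<comment> \<open>Slack: the lagged increments incur no coupling cost and no Lipschitz cost of
    grad f_p, but charging them as well lets the same \<delta> i multiply both lags.\<close>
  have "0 \<le> E * S (k - 1)" "0 \<le> J * sq (k - 1) p" "0 \<le> G * (Lp\<^sup>2 * sq (k - 1) p)"
    using E0 J0 S0 G0 by auto
  moreover have "\<Phi> k = L k + ca * ?a k + X k" for k
    by (simp add: \<Phi>_def ca_def t_def X_def m4_def)
  ultimately show ?thesis
    unfolding d using 4 by (simp add: algebra_simps)
qed

end

section \<open>The convergence rate\<close>

lemma exists_le_average:
  fixes g :: "nat \<Rightarrow> real"
  assumes "k \<ge> 1" "(\<Sum>j\<in>{1..k}. g j) \<le> C"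
  obtains j where "1 \<le> j" "j \<le> k" "g j \<le> C / real k"
proof -
  have "\<exists>j\<in>{1..k}. g j \<le> C / real k"
  proof (rule ccontr)
    assume "\<not> ?thesis"
    then have "\<forall>j\<in>{1..k}. C / real k < g j" by (simp add: not_le)
    then have "(\<Sum>j\<in>{1..k}. C / real k) < (\<Sum>j\<in>{1..k}. g j)"
      using assms(1) by (intro sum_strict_mono) auto
    then show False using assms by simp
  qed
  then show ?thesis using that by auto
qed

context nepj_admm
begin

abbreviation "dmin \<equiv> Min (\<delta> ` {1..p})"
abbreviation "D k \<equiv> (\<Sum>i\<in>{1..p}. \<delta> i * (sq k i + sq (k - 1) i))"
abbreviation "dl \<equiv> inverse (\<theta> * \<gamma> * (real p + 1) / (\<sigma> * dmin)
  * (2 * \<beta>\<^sup>2 * (opnorm At)\<^sup>2 * amax + Lp\<^sup>2 + 2 * (M p)\<^sup>2))"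

lemma dmin_le: "i \<in> {1..p} \<Longrightarrow> dmin \<le> \<delta> i"
  by (intro Min_le) auto

lemma dmin_pos: "0 < dmin"
proof -
  have "dmin \<in> \<delta> ` {1..p}" by (intro Min_in) auto
  then show ?thesis using delta_pos by auto
qed

lemma dlm_0: "At *\<^sub>v dlm 0 = 0\<^sub>v (n p)"
proof -
  have e: "dlm 0 = 0\<^sub>v d" by (intro eq_vecI) auto
  show ?thesis unfolding e by (intro eq_vecI) (auto intro!: scalar_prod_right_zero carrier_vecI)
qed

text \<open>The extra term is eta_0, so \<Phi> 0 - v is exactly the constant of the theorem.\<close>

lemma \<Phi>_0: "\<Phi> 0 = L 0 + m p / (4 * (M p)\<^sup>2) * (vnorm (At *\<^sub>v lam 0 - gp (xs 0 p)))\<^sup>2"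
proof -
  have ins: "{1..p} = insert p {1..<p}" by auto
  have "sq 0 i = 0" if "i \<in> {1..<p}" for i
  proof -
    have i: "i \<in> {1..p}" "i < p" using that by auto
    show ?thesis unfolding sq_less_p[OF i(2)] dx_0[OF i(1)] by simp
  qed
  then have "(\<Sum>i\<in>{1..p}. m i / 4 * sq 0 i) = m p / 4 * sq 0 p"
    unfolding ins by simp
  then show ?thesis unfolding \<Phi>_def dlm_0 by (simp add: sq_def err_def)
qed

lemma L_le_\<Phi>: "L k \<le> \<Phi> k"
proof -
  have "0 \<le> (\<Sum>i\<in>{1..p}. m i / 4 * sq k i)"
    using mM by (intro sum_nonneg mult_nonneg_nonneg) (auto intro: less_imp_le)
  moreover have "0 \<le> \<bar>\<theta> - 1\<bar> / ((1 - \<bar>\<theta> - 1\<bar>) * (\<beta> * \<theta> * \<sigma>)) * (vnorm (At *\<^sub>v dlm k))\<^sup>2"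
    using theta \<beta>_pos \<sigma>_pos
    by (intro mult_nonneg_nonneg divide_nonneg_nonneg) (auto simp: abs_if)
  ultimately show ?thesis unfolding \<Phi>_def by linarith
qed

lemma D_nonneg: "0 \<le> D k"
  using delta_pos by (intro sum_nonneg mult_nonneg_nonneg) (auto intro: less_imp_le)

lemma potential_bounds:
  shows v_le_\<Phi>_0: "v \<le> \<Phi> 0" and sum_D_le: "(\<Sum>j\<in>{1..k}. D j) \<le> \<Phi> 0 - v"
proof -
  have q: "0 \<le> (vnorm (lam k))\<^sup>2 / (2 * \<beta> * \<theta>)" for k
    using theta \<beta>_pos by simp
  show "v \<le> \<Phi> 0" "(\<Sum>j\<in>{1..k}. D j) \<le> \<Phi> 0 - v"
    using descent_bounds[of \<Phi> D L "\<lambda>k. (vnorm (lam k))\<^sup>2 / (2 * \<beta> * \<theta>)" v,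
        OF potential_descent D_nonneg L_le_\<Phi> q L_lower]
    by blast+
qed

text \<open>\<open>B\<close> is the sum of the coefficients that \<open>diff_U_le\<close> attaches
  to the different blocks, so it dominates each of them; what remains is the total of the
  \<open>sq\<close> terms, at most D k / dmin.\<close>

lemma diff_U_le_D:
  assumes k: "k \<ge> 1"
  defines "B \<equiv> 2 * \<beta>\<^sup>2 * (opnorm At)\<^sup>2 * amax + Lp\<^sup>2 + 2 * (M p)\<^sup>2"
  shows "(vnorm (U k - U (k - 1)))\<^sup>2 \<le> (real p + 1) * B / dmin * D k"
proof -
  define P where "P = 2 * \<beta>\<^sup>2 * (opnorm At)\<^sup>2 * amax"
  define S where "S = (\<Sum>i\<in>{1..<p}. sq k i + sq (k - 1) i)"
  have ins: "{1..p} = insert p {1..<p}" by auto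
  have B: "B = P + Lp\<^sup>2 + 2 * (M p)\<^sup>2" by (simp add: B_def P_def)
  have P0: "0 \<le> P" using amax_nonneg by (simp add: P_def)
  have S0: "0 \<le> S" by (simp add: S_def sum_nonneg)
  have tot: "(\<Sum>i\<in>{1..p}. sq k i + sq (k - 1) i) = S + (sq k p + sq (k - 1) p)"
    unfolding ins S_def by simp
  have "0 \<le> P * (sq k p + sq (k - 1) p)" "0 \<le> Lp\<^sup>2 * (S + sq (k - 1) p)" "0 \<le> (M p)\<^sup>2 * S"
    using P0 S0 by auto
  then have "Lp\<^sup>2 * sq k p + 2 * (M p)\<^sup>2 * (sq k p + sq (k - 1) p) + P * S
      \<le> B * (\<Sum>i\<in>{1..p}. sq k i + sq (k - 1) i)"
    unfolding tot B by (simp add: algebra_simps)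
  also have "\<dots> \<le> B * (D k / dmin)"
  proof (rule mult_left_mono)
    have "dmin * (\<Sum>i\<in>{1..p}. sq k i + sq (k - 1) i) \<le> D k"
      unfolding sum_distrib_left by (intro sum_mono mult_right_mono dmin_le) auto
    then show "(\<Sum>i\<in>{1..p}. sq k i + sq (k - 1) i) \<le> D k / dmin"
      using dmin_pos by (simp add: field_simps)
    show "0 \<le> B" using P0 by (simp add: B)
  qed
  finally have "(real p + 1) * (Lp\<^sup>2 * sq k p + 2 * (M p)\<^sup>2 * (sq k p + sq (k - 1) p) + P * S)
      \<le> (real p + 1) * (B * (D k / dmin))"
    by (intro mult_left_mono) auto
  then show ?thesis using diff_U_le[OF k] unfolding P_def S_def by simp
qed

lemma dl_pos: "0 < dl"
proof -
  have "0 < 2 * (M p)\<^sup>2" using M_pos[of p] by simp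
  moreover have "0 \<le> 2 * \<beta>\<^sup>2 * (opnorm At)\<^sup>2 * amax" using amax_nonneg by simp
  ultimately have "0 < 2 * \<beta>\<^sup>2 * (opnorm At)\<^sup>2 * amax + Lp\<^sup>2 + 2 * (M p)\<^sup>2"
    using zero_le_power2[of Lp] by linarith
  then show ?thesis
    using theta \<gamma>_pos \<sigma>_pos dmin_pos
    by (intro positive_imp_inverse_positive mult_pos_pos divide_pos_pos) auto
qed

text \<open>The inverse of \<open>dl\<close> is the product of the constants met on the way: (p + 1)
  B / dmin from \<open>diff_U_le_D\<close>, \<theta> \<gamma> from the relaxation and 1/\<sigma>
  from the eigenvalue bound.\<close>

lemma sum_dlm_le: "(\<Sum>j\<in>{1..k}. dl * (vnorm (dlm j))\<^sup>2) \<le> (\<Sum>j\<in>{1..k}. D j)"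
proof -
  define t where "t = \<bar>\<theta> - 1\<bar>"
  define B where "B = 2 * \<beta>\<^sup>2 * (opnorm At)\<^sup>2 * amax + Lp\<^sup>2 + 2 * (M p)\<^sup>2"
  define C where "C = \<theta> * \<gamma> * ((real p + 1) * B / dmin)"
  let ?a = "\<lambda>k. (vnorm (At *\<^sub>v dlm k))\<^sup>2"
  have t: "0 \<le> t / (1 - t)" using theta by (auto simp: t_def)
  \<comment> \<open>The subtracted last term is what telescoping leaves behind; the term at index 0
    vanishes because \<open>dlm 0\<close> is zero.\<close>
  have "(\<Sum>j\<in>{1..k}. ?a j) \<le> C * (\<Sum>j\<in>{1..k}. D j) - t / (1 - t) * ?a k"
  proof (induction k)
    case 0
    then show ?case by (simp add: dlm_0[simplified])
  next
    case (Suc k)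
    have "?a (Suc k) \<le> t / (1 - t) * (?a k - ?a (Suc k)) + \<theta> * \<gamma> * (vnorm (U (Suc k) - U k))\<^sup>2"
      using At_dlm_le[of "Suc k"] by (simp add: t_def)
    also have "\<theta> * \<gamma> * (vnorm (U (Suc k) - U k))\<^sup>2 \<le> C * D (Suc k)"
      using mult_left_mono[OF diff_U_le_D[of "Suc k"], of "\<theta> * \<gamma>"] theta \<gamma>_pos
      by (simp add: C_def B_def)
    finally have "?a (Suc k) \<le> t / (1 - t) * (?a k - ?a (Suc k)) + C * D (Suc k)" by simp
    moreover have "(\<Sum>j\<in>{1..Suc k}. ?a j) = (\<Sum>j\<in>{1..k}. ?a j) + ?a (Suc k)"
      "(\<Sum>j\<in>{1..Suc k}. D j) = (\<Sum>j\<in>{1..k}. D j) + D (Suc k)"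
      by simp_all
    ultimately show ?case using Suc by (simp only: right_diff_distrib distrib_left)
  qed
  moreover have "0 \<le> t / (1 - t) * ?a k" using t by (intro mult_nonneg_nonneg) auto
  ultimately have "(\<Sum>j\<in>{1..k}. ?a j) \<le> C * (\<Sum>j\<in>{1..k}. D j)" by linarith
  moreover have "(\<Sum>j\<in>{1..k}. \<sigma> * (vnorm (dlm j))\<^sup>2) \<le> (\<Sum>j\<in>{1..k}. ?a j)"
    by (intro sum_mono vnorm_dlm_le) auto
  ultimately have "\<sigma> * (\<Sum>j\<in>{1..k}. (vnorm (dlm j))\<^sup>2) \<le> C * (\<Sum>j\<in>{1..k}. D j)"
    by (simp only: sum_distrib_left)
  then have "(\<Sum>j\<in>{1..k}. (vnorm (dlm j))\<^sup>2) \<le> C / \<sigma> * (\<Sum>j\<in>{1..k}. D j)"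
    using \<sigma>_pos by (simp add: field_simps)
  also have "C / \<sigma> = inverse dl"
  proof -
    have "a * (r * c / x) / y = a * r / (y * x) * c" for a r c x y :: real
      by (simp add: ac_simps)
    then show ?thesis unfolding C_def B_def inverse_inverse_eq .
  qed
  finally have "dl * (\<Sum>j\<in>{1..k}. (vnorm (dlm j))\<^sup>2) \<le> dl * (inverse dl * (\<Sum>j\<in>{1..k}. D j))"
    using dl_pos by (intro mult_left_mono) (auto intro: less_imp_le)
  also have "\<dots> = (\<Sum>j\<in>{1..k}. D j)"
  proof -
    have "x * (inverse x * s) = s" if "0 < x" for x s :: real
      using that by simp
    from this[OF dl_pos] show ?thesis .
  qed
  finally show ?thesis by (simp only: sum_distrib_left)
qed

lemma Rv_le:
  assumes k: "k \<ge> 1" and i: "i \<in> {1..p}" and c: "\<And>l. l \<in> {1..p} \<Longrightarrow> vnorm (dx k l) \<le> c"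
  shows "vnorm (Rv k i) \<le> ((\<Sum>l\<in>{1..p} - {i}. \<beta> * opnorm ((A i)\<^sup>T * A l)) + M i) * c"
proof -
  let ?g = "gw k i (xs k i) - gw k i (xs (k - 1) i)"
  let ?s = "vsum (n i) (\<lambda>j. (A i)\<^sup>T *\<^sub>v adx k j) ({1..p} - {i})"
  have gc: "?g \<in> carrier_vec (n i)" using gw_xs_carrier[OF k i] by auto
  have "vnorm ?g \<le> M i * vnorm (dx k i)"
    using w_class[OF k i] xs_edom[OF i] unfolding dgf_class_def by blast
  also have "\<dots> \<le> M i * c" using c[OF i] M_pos[OF i] by simp
  finally have 1: "vnorm ?g \<le> M i * c" .
  have "vnorm ?s \<le> (\<Sum>l\<in>{1..p} - {i}. vnorm ((A i)\<^sup>T *\<^sub>v adx k l))"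
    using At_dim[OF i] by (intro vnorm_vsum_le) auto
  also have "\<dots> \<le> (\<Sum>l\<in>{1..p} - {i}. opnorm ((A i)\<^sup>T * A l) * c)"
  proof (rule sum_mono)
    fix l assume "l \<in> {1..p} - {i}"
    then have l: "l \<in> {1..p}" by simp
    have "(A i)\<^sup>T *\<^sub>v adx k l = ((A i)\<^sup>T * A l) *\<^sub>v dx k l"
      using l by (subst assoc_mult_mat_vec[OF At_dim[OF i] A_dim[OF l]]) auto
    then have "vnorm ((A i)\<^sup>T *\<^sub>v adx k l) \<le> opnorm ((A i)\<^sup>T * A l) * vnorm (dx k l)"
      using vnorm_mult_mat_vec_le[OF mult_carrier_mat[OF At_dim[OF i] A_dim[OF l]], of "dx k l"] l by simp
    also have "\<dots> \<le> opnorm ((A i)\<^sup>T * A l) * c"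
      by (intro mult_left_mono c l opnorm_nonneg)
    finally show "vnorm ((A i)\<^sup>T *\<^sub>v adx k l) \<le> opnorm ((A i)\<^sup>T * A l) * c" .
  qed
  finally have "\<beta> * vnorm ?s \<le> \<beta> * (\<Sum>l\<in>{1..p} - {i}. opnorm ((A i)\<^sup>T * A l) * c)"
    using \<beta>_pos by (intro mult_left_mono) auto
  then have 2: "\<beta> * vnorm ?s \<le> (\<Sum>l\<in>{1..p} - {i}. \<beta> * opnorm ((A i)\<^sup>T * A l)) * c"
    by (simp add: sum_distrib_left sum_distrib_right mult.assoc)
  have "Rv k i = ?g + (- \<beta>) \<cdot>\<^sub>v ?s"
    unfolding Rv_def using carrier_vecD[OF gc] by (intro eq_vecI) auto
  then have "vnorm (Rv k i) \<le> vnorm ?g + \<beta> * vnorm ?s"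
    using vnorm_triangle[OF gc, of "(- \<beta>) \<cdot>\<^sub>v ?s"] \<beta>_pos by simp
  then show ?thesis using 1 2 by (simp add: distrib_right)
qed

text \<open>One index must serve the primal and the dual bound, so the two sequences are added
  before averaging. Each sums to at most \<Phi> 0 - v, whence the factor 2 under the roots.\<close>

lemma rate:
  assumes k: "k \<ge> 1"
  obtains j where "1 \<le> j" "j \<le> k"
    "\<And>i. i \<in> {1..p} \<Longrightarrow> vnorm (Rv j i) \<le> ((\<Sum>l\<in>{1..p} - {i}. \<beta> * opnorm ((A i)\<^sup>T * A l)) + M i)
       * sqrt (2 * (\<Phi> 0 - v) / (real k * dmin))"
    "vnorm (res j) \<le> 1 / (\<beta> * \<theta>) * sqrt (2 * (\<Phi> 0 - v) / (real k * dl))"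
proof -
  have "(\<Sum>j\<in>{1..k}. D j + dl * (vnorm (dlm j))\<^sup>2) \<le> (\<Phi> 0 - v) + (\<Phi> 0 - v)"
    unfolding sum.distrib by (rule add_mono[OF sum_D_le order_trans[OF sum_dlm_le sum_D_le]])
  then have "(\<Sum>j\<in>{1..k}. D j + dl * (vnorm (dlm j))\<^sup>2) \<le> 2 * (\<Phi> 0 - v)"
    by (simp only: mult_2)
  from exists_le_average[OF k this] obtain j where j: "1 \<le> j" "j \<le> k"
    and le: "D j + dl * (vnorm (dlm j))\<^sup>2 \<le> 2 * (\<Phi> 0 - v) / real k" .
  have dlm0: "0 \<le> dl * (vnorm (dlm j))\<^sup>2" using dl_pos by (intro mult_nonneg_nonneg) (auto intro: less_imp_le)
  have "vnorm (dx j i) \<le> sqrt (2 * (\<Phi> 0 - v) / (real k * dmin))" if i: "i \<in> {1..p}" for i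
  proof -
    have "dmin * (vnorm (dx j i))\<^sup>2 \<le> \<delta> i * (sq j i + sq (j - 1) i)"
      using dmin_le[OF i] less_imp_le[OF delta_pos[OF i]] j by (intro mult_mono) (auto simp: sq_pos_index)
    also have "\<dots> \<le> D j"
      using i delta_pos by (intro member_le_sum mult_nonneg_nonneg) (auto intro: less_imp_le)
    also have "\<dots> \<le> 2 * (\<Phi> 0 - v) / real k" using le dlm0 by linarith
    finally have "(vnorm (dx j i))\<^sup>2 \<le> 2 * (\<Phi> 0 - v) / real k / dmin"
      by (subst pos_le_divide_eq[OF dmin_pos]) (simp only: mult.commute)
    then show ?thesis by (intro real_le_rsqrt) (simp only: divide_divide_eq_left)
  qed
  then have 1: "\<And>i. i \<in> {1..p} \<Longrightarrow> vnorm (Rv j i) \<le> ((\<Sum>l\<in>{1..p} - {i}. \<beta> * opnorm ((A i)\<^sup>T * A l)) + M i)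
       * sqrt (2 * (\<Phi> 0 - v) / (real k * dmin))"
    using Rv_le[OF j(1)] by blast
  have "dl * (vnorm (dlm j))\<^sup>2 \<le> 2 * (\<Phi> 0 - v) / real k" using le D_nonneg[of j] by linarith
  then have "(vnorm (dlm j))\<^sup>2 \<le> 2 * (\<Phi> 0 - v) / real k / dl"
    by (subst pos_le_divide_eq[OF dl_pos]) (simp only: mult.commute)
  then have "vnorm (dlm j) \<le> sqrt (2 * (\<Phi> 0 - v) / (real k * dl))"
    by (intro real_le_rsqrt) (simp only: divide_divide_eq_left)
  moreover have "r \<le> 1 / (\<beta> * \<theta>) * c" if "\<theta> * \<beta> * r \<le> c" for r c
    using that theta \<beta>_pos by (simp add: field_simps)
  ultimately have "vnorm (res j) \<le> 1 / (\<beta> * \<theta>) * sqrt (2 * (\<Phi> 0 - v) / (real k * dl))"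
    unfolding vnorm_dlm[OF j(1)] by blast
  with that j 1 show ?thesis by blast
qed

lemma aug_lag_xs: "aug_lag p d f A b \<beta> (xs 0) (lam 0) = ereal (L 0)"
  unfolding L_def by (intro aug_lag_ereal f_xs)

end

theorem mainTheorem1:
  fixes p d :: nat and n :: "nat \<Rightarrow> nat"
    and f :: "nat \<Rightarrow> real vec \<Rightarrow> ereal" and A :: "nat \<Rightarrow> real mat" and b :: "real vec"
    and gp :: "real vec \<Rightarrow> real vec" and Lp :: real and \<beta>bar :: real
    and \<alpha> \<beta> \<theta> :: real and m M :: "nat \<Rightarrow> real"
    and xs :: "nat \<Rightarrow> nat \<Rightarrow> real vec" and lam :: "nat \<Rightarrow> real vec"
    and w :: "nat \<Rightarrow> nat \<Rightarrow> real vec \<Rightarrow> real" and gw :: "nat \<Rightarrow> nat \<Rightarrow> real vec \<Rightarrow> real vec"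
    and lamhat :: "nat \<Rightarrow> real vec" and R :: "nat \<Rightarrow> nat \<Rightarrow> real vec"
    and \<Delta>L0 :: ereal and dlam :: real
  assumes p2: "p \<ge> 2"
    and A_dim: "\<forall>i\<in>{1..p}. A i \<in> carrier_mat d (n i)"
    and b_dim: "b \<in> carrier_vec d"
    \<comment> \<open>(A0)\<close>
    and A0: "\<forall>i\<in>{1..<p}. proper_fun (n i) (f i) \<and> lsc_fun (n i) (f i)"
    \<comment> \<open>(A1)\<close>
    and A1_nz: "A p \<noteq> 0\<^sub>m d (n p)"
    and A1_b: "\<exists>y\<in>carrier_vec (n p). A p *\<^sub>v y = b"
    and A1_im: "\<forall>i\<in>{1..<p}. \<forall>x\<in>carrier_vec (n i). \<exists>y\<in>carrier_vec (n p). A p *\<^sub>v y = A i *\<^sub>v x"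
    \<comment> \<open>(A2)\<close>
    and A2_real: "\<forall>x\<in>carrier_vec (n p). \<bar>f p x\<bar> \<noteq> \<infinity>"
    and A2_grad: "\<forall>x\<in>carrier_vec (n p). has_grad (n p) (\<lambda>y. real_of_ereal (f p y)) (gp x) x"
    and A2_lip: "\<forall>x\<in>carrier_vec (n p). \<forall>y\<in>carrier_vec (n p). vnorm (gp x - gp y) \<le> Lp * vnorm (x - y)"
    \<comment> \<open>(A3)\<close>
    and A3: "\<beta>bar \<ge> 0" "val_fun p n d f A b \<beta>bar > -\<infinity>"
    \<comment> \<open>parameters of NEPJ-ADMM\<close>
    and x0: "\<forall>i\<in>{1..p}. xs 0 i \<in> edom (n i) (f i)"
    and lam0: "lam 0 \<in> carrier_vec d"
    and alpha: "\<alpha> > 0" and beta: "\<beta> \<ge> \<beta>bar" "\<beta> > 0"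
    and mM: "\<forall>i\<in>{1..p}. 0 < m i \<and> m i \<le> M i"
    and theta: "0 < \<theta>" "\<theta> < 2"
    and delta_pos: "\<forall>i\<in>{1..p}. delta_par p A Lp \<alpha> \<beta> \<theta> m M i > 0"
    \<comment> \<open>iterations\<close>
    and w_class: "\<forall>k\<ge>1. \<forall>i\<in>{1..p}. dgf_class (n i) (edom (n i) (f i)) (m i) (M i) (w k i) (gw k i)"
    and x_step: "\<forall>k\<ge>1. \<forall>i\<in>{1..p}. xs k i \<in> carrier_vec (n i) \<and>
        (\<forall>y\<in>carrier_vec (n i).
           aug_lag p d f A b \<beta> ((xs (k - 1))(i := xs k i)) (lam (k - 1))
             + ereal (bregman (w k i) (gw k i) (xs (k - 1) i) (xs k i))
           \<le> aug_lag p d f A b \<beta> ((xs (k - 1))(i := y)) (lam (k - 1))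
             + ereal (bregman (w k i) (gw k i) (xs (k - 1) i) y))"
    and lam_step: "\<forall>k\<ge>1. lam k = lam (k - 1) - (\<theta> * \<beta>) \<cdot>\<^sub>v resid p d A b (xs k)"
    \<comment> \<open>notation\<close>
    and lamhat_def: "\<And>k. lamhat k = lam (k - 1) - \<beta> \<cdot>\<^sub>v resid p d A b (xs k)"
    and R_def: "\<And>k i. R k i =
        vec (n i) (\<lambda>r. - (\<Sum>j\<in>{1..p} - {i}. (\<beta> \<cdot>\<^sub>v ((A i)\<^sup>T *\<^sub>v (A j *\<^sub>v (xs k j - xs (k - 1) j)))) $ r))
        + (gw k i (xs k i) - gw k i (xs (k - 1) i))"
    and \<Delta>L0_def: "\<Delta>L0 = aug_lag p d f A b \<beta> (xs 0) (lam 0) - val_fun p n d f A b \<beta>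
        + ereal (m p / (4 * (M p)\<^sup>2) * (vnorm ((A p)\<^sup>T *\<^sub>v lam 0 - gp (xs 0 p)))\<^sup>2)"
    and dlam_def: "dlam = inverse (\<theta> * gamma_theta \<theta> * (real p + 1)
          / (sigma_plus (A p) * Min ((delta_par p A Lp \<alpha> \<beta> \<theta> m M) ` {1..p}))
          * (2 * \<beta>\<^sup>2 * (opnorm ((A p)\<^sup>T))\<^sup>2 * Max ((\<lambda>l. (opnorm (A l))\<^sup>2) ` {1..<p}) + Lp\<^sup>2 + 2 * (M p)\<^sup>2))"
  shows "\<Delta>L0 \<ge> 0 \<and> \<Delta>L0 \<noteq> \<infinity> \<and>
    (\<forall>k\<ge>1.
       (\<forall>i\<in>{1..p}. \<exists>v\<in>limiting_subdiff (n i) (f i) (xs k i).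
           v - (A i)\<^sup>T *\<^sub>v lamhat k + R k i = 0\<^sub>v (n i)) \<and>
       (\<exists>j. 1 \<le> j \<and> j \<le> k \<and>
          (\<forall>i\<in>{1..p}. vnorm (R j i) \<le>
             ((\<Sum>l\<in>{1..p} - {i}. \<beta> * opnorm ((A i)\<^sup>T * A l)) + M i)
             * sqrt (2 * real_of_ereal \<Delta>L0 / (real k * Min ((delta_par p A Lp \<alpha> \<beta> \<theta> m M) ` {1..p})))) \<and>
          vnorm (resid p d A b (xs j)) \<le> 1 / (\<beta> * \<theta>) * sqrt (2 * real_of_ereal \<Delta>L0 / (real k * dlam))))"
proof -
  \<comment> \<open>A larger penalty only raises the infimum, so finiteness from below passes from
    \<beta>bar to \<beta>.\<close>
  have v_mono: "val_fun p n d f A b \<beta>bar \<le> val_fun p n d f A b \<beta>"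
    unfolding val_fun_def using beta
    by (intro INF_superset_mono[OF subset_refl] add_left_mono) (simp add: mult_right_mono)
  interpret nepj_admm p d n f A b gp Lp \<alpha> \<beta> \<theta> m M xs lam w gw
  proof unfold_locales
    show "val_fun p n d f A b \<beta> > -\<infinity>" using A3(2) v_mono by (rule less_le_trans)
  qed (use assms in \<open>simp_all\<close>)
  have \<Delta>: "\<Delta>L0 = ereal (\<Phi> 0 - v)"
    unfolding \<Delta>L0_def aug_lag_xs \<Phi>_0 by (subst val_fun_ereal) simp
  have R: "R k i = Rv k i" if "k \<ge> 1" "i \<in> {1..p}" for k i
  proof -
    have g: "gw k i (xs k i) \<in> carrier_vec (n i)" "gw k i (xs (k - 1) i) \<in> carrier_vec (n i)"
      using gw_xs_carrier[OF that] by auto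
    show ?thesis
      unfolding R_def Rv_def using carrier_vecD[OF g(1)] carrier_vecD[OF g(2)] carrier_matD[OF At_dim[OF that(2)]]
      by (intro eq_vecI) (auto simp: sum_distrib_left)
  qed
  have lh: "lamhat k = lamh k" for k by (simp add: lamhat_def lamh_def)
  have opt: "\<exists>v\<in>limiting_subdiff (n i) (f i) (xs k i). v - (A i)\<^sup>T *\<^sub>v lamhat k + R k i = 0\<^sub>v (n i)"
    if k: "k \<ge> 1" and i: "i \<in> {1..p}" for k i
  proof
    \<comment> \<open>The witness is a Frechet subgradient at the iterate itself, so constant
      sequences place it in the limiting subdifferential.\<close>
    show "(A i)\<^sup>T *\<^sub>v lamh k - Rv k i \<in> limiting_subdiff (n i) (f i) (xs k i)"
      using optimality[OF k i] frechet_subdiff_subset_limiting by blast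
    show "(A i)\<^sup>T *\<^sub>v lamh k - Rv k i - (A i)\<^sup>T *\<^sub>v lamhat k + R k i = 0\<^sub>v (n i)"
      unfolding R[OF k i] lh using carrier_matD[OF At_dim[OF i]] by (intro eq_vecI) auto
  qed
  show ?thesis
  proof (intro conjI allI impI ballI)
    show "\<Delta>L0 \<ge> 0" using v_le_\<Phi>_0 by (simp add: \<Delta>)
    show "\<Delta>L0 \<noteq> \<infinity>" by (simp add: \<Delta>)
    fix k :: nat assume k: "k \<ge> 1"
    show "\<exists>v\<in>limiting_subdiff (n i) (f i) (xs k i). v - (A i)\<^sup>T *\<^sub>v lamhat k + R k i = 0\<^sub>v (n i)"
      if "i \<in> {1..p}" for i
      using opt[OF k that] .
    show "\<exists>j. 1 \<le> j \<and> j \<le> k \<and>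
          (\<forall>i\<in>{1..p}. vnorm (R j i) \<le>
             ((\<Sum>l\<in>{1..p} - {i}. \<beta> * opnorm ((A i)\<^sup>T * A l)) + M i)
             * sqrt (2 * real_of_ereal \<Delta>L0 / (real k * Min ((delta_par p A Lp \<alpha> \<beta> \<theta> m M) ` {1..p})))) \<and>
          vnorm (resid p d A b (xs j)) \<le> 1 / (\<beta> * \<theta>) * sqrt (2 * real_of_ereal \<Delta>L0 / (real k * dlam))"
      unfolding \<Delta> real_of_ereal.simps dlam_def
      using rate[OF k] R by metis
  qed
qed

end
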